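(* Let $K\ge 2$, let $\mu_B\in(0,1)$ and $\mu_R=1-\mu_B$, and suppose that in every period the blue die is chosen with probability $\mu_B$ (and the red die otherwise), independently of the past. Suppose that the prior densities $\pi$ and $\varrho$ on $\Delta$ both satisfy Condition $\mathcal P$ (possibly with different exponent vectors). Let $\bar k\in\{1,\dots,K\}$ and $\epsilon\in(0,1)$. Then there exists $N\in\mathbb N$ such that for all $\vartheta=(p,q)\in\Delta^2$ and $n\in\mathbb N$ with $p_{\bar k}\ge q_{\bar k}$ and $np_{\bar k}\ge N$, the following holds with $\mathbb P_\vartheta$-probability at least $1-\epsilon$: the posterior odds ratio of "blue" relative to "red" after data $X^n$ and the information that the $(n+1)$-th toss landed on side $\bar k$ (with the color of the $(n+1)$-th die not observed), namely \[ \frac{\mu_B\int p_{\bar k}\,\pi(p\,|\,X^n)\,d\lambda(p)}{\mu_R\int q_{\bar k}\,\varrho(q\,|\,X^n)\,d\lambda(q)}, \] exceeds $(1-\epsilon)\cdot\frac{\mu_B}{\mu_R}$.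
   Context: $\mathbb N$ is the set of positive integers. $\Delta=\{p\in[0,1]^K: p_1+\dots+p_K=1\}$, $\operatorname{int}\Delta$ is its (relative) interior, i.e. the points with all coordinates positive, and $\lambda$ is the Lebesgue measure on $\Delta$ normalized by $\lambda(\Delta)=1/(K-1)!$. A density on $\Delta$ means a probability density with respect to $\lambda$. Condition $\mathcal P$: a density $\pi$ on $\Delta$ satisfies Condition $\mathcal P(\alpha)$, where $\alpha=(\alpha_1,\dots,\alpha_K)\in(0,\infty)^K$, if $\pi(p)/\prod_{k=1}^K p_k^{\alpha_k-1}$ is uniformly continuous and bounded away from zero on $\operatorname{int}\Delta$; $\pi$ satisfies Condition $\mathcal P$ if it satisfies $\mathcal P(\alpha)$ for some $\alpha\in(0,\infty)^K$. Setting: there are two $K$-sided dice, blue and red. In each period one die is chosen at random as described and tossed. The blue die lands on side $k$ with probability $p_k$, the red die with probability $q_k$, independently of past outcomes; the parameter is $\vartheta=(p,q)\in\Delta^2$ and $\mathbb P_\vartheta$ is the probability under $\vartheta$. $X^n$ denotes the (observed) colors and sides of the first $n$ tosses. The observer's prior on $\Delta^2$ has the product density $\pi(p)\varrho(q)$. The posterior densities are as follows: if $y_i$ (resp. $z_i$) is the number of times the blue (resp. red) die lands on side $i$ in the first $n$ periods, then \[ \pi(p\,|\,X^n)=\frac{\prod_{i=1}^K p_i^{y_i}\,\pi(p)}{\int \prod_{i=1}^K s_i^{y_i}\,\pi(s)\,d\lambda(s)},\qquad \varrho(q\,|\,X^n)=\frac{\prod_{i=1}^K q_i^{z_i}\,\varrho(q)}{\int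 \prod_{i=1}^K s_i^{z_i}\,\varrho(s)\,d\lambda(s)}. \] *)

theory Defs
  imports "HOL-Probability.Probability"
begin

definition prob_simplex :: "(real ^ 'k::finite) set" where
  "prob_simplex = {p. (\<forall>i. p $ i \<in> {0..1}) \<and> (\<Sum>i\<in>UNIV. p $ i) = 1}"

lemma prob_simplex_nonneg_iff:
  "p \<in> prob_simplex \<longleftrightarrow> (\<forall>i. 0 \<le> p $ i) \<and> (\<Sum>i\<in>UNIV. p $ i) = 1"
proof -
  have "p $ i \<le> (\<Sum>j\<in>UNIV. p $ j)" if "\<forall>i. 0 \<le> p $ i" for i
    by (rule member_le_sum) (use that in auto)
  then show ?thesis by (auto simp: prob_simplex_def)
qed

lemma sets_prob_simplex [measurable]: "(prob_simplex :: (real ^ 'k::finite) set) \<in> sets borel"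
proof -
  have "prob_simplex = (\<Inter>i. {p::real^'k. 0 \<le> p $ i}) \<inter> {p. (\<Sum>i\<in>UNIV. p $ i) = 1}"
    by (auto simp: prob_simplex_nonneg_iff)
  moreover have "closed \<dots>"
    by (intro closed_Int closed_INT ballI closed_Collect_le closed_Collect_eq continuous_intros)
  ultimately show ?thesis by simp
qed

lemma rel_interior_prob_simplex:
  "rel_interior (prob_simplex :: (real ^ 'k::finite) set) = {p \<in> prob_simplex. \<forall>i. 0 < p $ i}"
proof -
  have inj: "inj (\<lambda>i::'k. axis i (1::real))"
    by (auto simp: inj_on_def axis_eq_axis)
  have Basis_eq: "(Basis :: (real^'k) set) = range (\<lambda>i. axis i 1)"
    by (auto simp: Basis_vec_def)
  have sum_axis: "(\<Sum>x\<in>range (\<lambda>i::'k. axis i (1::real)). u x *\<^sub>R x) = (\<chi> i. u (axis i 1))" for u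
  proof -
    have "(\<Sum>x\<in>range (\<lambda>i::'k. axis i (1::real)). u x *\<^sub>R x) = (\<Sum>i\<in>UNIV. u (axis i 1) *\<^sub>R axis i 1)"
      by (subst sum.reindex[OF inj]) simp
    then show ?thesis
      by (simp add: vec_eq_iff axis_def if_distrib cong: if_cong)
  qed
  have sum_u: "sum u (range (\<lambda>i::'k. axis i (1::real))) = (\<Sum>i\<in>UNIV. u (axis i 1))" for u :: "real^'k \<Rightarrow> real"
    by (subst sum.reindex[OF inj]) simp
  let ?w = "\<lambda>p::real^'k. \<lambda>x. p \<bullet> x"
  have w: "?w p (axis i 1) = p $ i" for p i
    by (simp add: inner_axis)
  have hull: "prob_simplex = convex hull (Basis :: (real^'k) set)"
  proof (intro set_eqI iffI)
    fix p :: "real^'k" assume "p \<in> prob_simplex"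
    then show "p \<in> convex hull Basis"
      by (auto simp: convex_hull_finite Basis_eq sum_axis sum_u prob_simplex_nonneg_iff w vec_eq_iff
          intro!: exI[of _ "?w p"])
  next
    fix p :: "real^'k" assume "p \<in> convex hull Basis"
    then show "p \<in> prob_simplex"
      by (auto simp: convex_hull_finite Basis_eq sum_axis sum_u prob_simplex_nonneg_iff)
  qed
  have "\<not> affine_dependent (Basis :: (real^'k) set)"
    using independent_Basis affine_dependent_imp_dependent by blast
  from rel_interior_convex_hull_explicit[OF this]
  have *: "rel_interior (prob_simplex :: (real^'k) set) =
      {y. \<exists>u. (\<forall>x\<in>Basis. 0 < u x) \<and> sum u Basis = 1 \<and> (\<Sum>x\<in>Basis. u x *\<^sub>R x) = y}"
    by (simp add: hull)
  show ?thesis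
  proof (intro set_eqI iffI)
    fix p :: "real^'k" assume "p \<in> rel_interior prob_simplex"
    then show "p \<in> {p \<in> prob_simplex. \<forall>i. 0 < p $ i}"
      unfolding * by (auto simp: Basis_eq sum_axis sum_u prob_simplex_nonneg_iff less_imp_le)
  next
    fix p :: "real^'k" assume "p \<in> {p \<in> prob_simplex. \<forall>i. 0 < p $ i}"
    then show "p \<in> rel_interior prob_simplex"
      unfolding * by (auto simp: Basis_eq sum_axis sum_u prob_simplex_nonneg_iff w vec_eq_iff
          intro!: exI[of _ "?w p"])
  qed
qed

text \<open>
  The hyperplane of vectors with coordinate sum 1 is parametrised by all coordinates but one; the
  omitted coordinate is arbitrary, since the transition map between two such charts is affine with
  determinant of absolute value 1.
\<close>

definition omitted :: "'k::finite" where
  "omitted = (SOME i. True)"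

definition hyperplane_chart :: "('k::finite \<Rightarrow> real) \<Rightarrow> real ^ 'k" where
  "hyperplane_chart x = (\<chi> i. if i = omitted then 1 - (\<Sum>j\<in>-{omitted}. x j) else x i)"

definition simplex_lebesgue :: "(real ^ 'k::finite) measure" where
  "simplex_lebesgue = completion (restrict_space
     (distr (\<Pi>\<^sub>M i\<in>-{omitted}. lborel) borel hyperplane_chart) prob_simplex)"

lemma measurable_hyperplane_chart [measurable]:
  "hyperplane_chart \<in> borel_measurable (\<Pi>\<^sub>M i\<in>-{omitted}. lborel)"
proof -
  have "(\<lambda>x. hyperplane_chart x \<bullet> b) \<in> borel_measurable (\<Pi>\<^sub>M i\<in>-{omitted}. lborel)"
    if b: "b \<in> Basis" for b :: "real^'k"
  proof -
    obtain i where "b = axis i 1" using b by (auto simp: Basis_vec_def)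
    then show ?thesis
      by (cases "i = omitted") (auto simp: hyperplane_chart_def inner_axis)
  qed
  then show ?thesis by (subst borel_measurable_euclidean_space) blast
qed

lemma space_simplex_lebesgue [simp]: "space simplex_lebesgue = prob_simplex"
  by (simp add: simplex_lebesgue_def space_restrict_space)

lemma emeasure_simplex_lebesgue:
  "emeasure simplex_lebesgue (prob_simplex :: (real ^ 'k::finite) set) = ennreal (1 / fact (CARD('k) - 1))"
proof -
  let ?o = "omitted :: 'k"
  let ?M = "\<Pi>\<^sub>M i\<in>-{?o}. (lborel :: real measure)"
  have "emeasure simplex_lebesgue (prob_simplex :: (real ^ 'k) set) =
      emeasure (restrict_space (distr ?M borel hyperplane_chart) prob_simplex) (prob_simplex :: (real ^ 'k) set)"
  proof -
    have "prob_simplex \<in> sets (restrict_space (distr ?M borel hyperplane_chart) (prob_simplex :: (real ^ 'k) set))"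
      using sets.top[of "restrict_space (distr ?M borel hyperplane_chart) (prob_simplex :: (real ^ 'k) set)"]
      by (simp add: space_restrict_space)
    then show ?thesis
      by (simp add: simplex_lebesgue_def main_part_sets sets_completionI_sets)
  qed
  also have "\<dots> = emeasure ?M (hyperplane_chart -` prob_simplex \<inter> space ?M)"
    by (subst emeasure_restrict_space) (auto simp: emeasure_distr)
  also have "hyperplane_chart -` prob_simplex \<inter> space ?M =
      {x. (\<forall>i\<in>-{?o}. 0 \<le> x i) \<and> sum x (-{?o}) \<le> 1} \<inter> space ?M"
  proof -
    have "(hyperplane_chart x \<in> prob_simplex) \<longleftrightarrow> (\<forall>i\<in>-{?o}. 0 \<le> x i) \<and> sum x (-{?o}) \<le> 1" for x
    proof -
      have "(\<Sum>i\<in>UNIV. hyperplane_chart x $ i) =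
          hyperplane_chart x $ ?o + (\<Sum>i\<in>UNIV-{?o}. hyperplane_chart x $ i)"
        by (rule sum.remove) auto
      also have "\<dots> = 1"
        by (simp add: hyperplane_chart_def Compl_eq_Diff_UNIV)
      finally have "(\<Sum>i\<in>UNIV. hyperplane_chart x $ i) = 1" .
      then show ?thesis
        by (auto simp: prob_simplex_nonneg_iff hyperplane_chart_def split: if_splits)
    qed
    then show ?thesis by auto
  qed
  also have "emeasure ?M \<dots> = ennreal (1 / fact (CARD('k) - 1))"
    by (subst emeasure_std_simplex_aux) (auto simp: Compl_eq_Diff_UNIV)
  finally show ?thesis .
qed

definition simplex_density :: "(real ^ 'k::finite \<Rightarrow> real) \<Rightarrow> bool" where
  "simplex_density f \<longleftrightarrow>
     f \<in> borel_measurable simplex_lebesgue \<and> (\<forall>p\<in>prob_simplex. 0 \<le> f p) \<and>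
     (\<integral>\<^sup>+ p. ennreal (f p) \<partial>simplex_lebesgue) = 1"

definition condition_P_at :: "real ^ 'k::finite \<Rightarrow> (real ^ 'k \<Rightarrow> real) \<Rightarrow> bool" where
  "condition_P_at \<alpha> f \<longleftrightarrow>
     (let g = (\<lambda>p. f p / (\<Prod>i\<in>UNIV. p $ i powr (\<alpha> $ i - 1))) in
        uniformly_continuous_on (rel_interior prob_simplex) g \<and>
        (\<exists>c>0. \<forall>p\<in>rel_interior prob_simplex. c \<le> g p))"

definition condition_P :: "(real ^ 'k::finite \<Rightarrow> real) \<Rightarrow> bool" where
  "condition_P f \<longleftrightarrow> (\<exists>\<alpha>. (\<forall>i. 0 < \<alpha> $ i) \<and> condition_P_at \<alpha> f)"

datatype color = Blue | Red

definition color_pmf :: "real \<Rightarrow> color pmf" where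
  "color_pmf \<mu> = map_pmf (\<lambda>b. if b then Blue else Red) (bernoulli_pmf \<mu>)"

definition die_pmf :: "real ^ 'k::finite \<Rightarrow> 'k pmf" where
  "die_pmf p = embed_pmf (\<lambda>i. p $ i)"

definition toss_pmf :: "real \<Rightarrow> real ^ 'k::finite \<Rightarrow> real ^ 'k \<Rightarrow> (color \<times> 'k) pmf" where
  "toss_pmf \<mu> p q =
     bind_pmf (color_pmf \<mu>) (\<lambda>c. map_pmf (Pair c) (die_pmf (case c of Blue \<Rightarrow> p | Red \<Rightarrow> q)))"

lemma pmf_die_pmf:
  fixes p :: "real ^ 'k::finite"
  assumes "p \<in> prob_simplex"
  shows "pmf (die_pmf p) i = p $ i"
  unfolding die_pmf_def
proof (rule pmf_embed_pmf)
  have "(\<integral>\<^sup>+ i. ennreal (p $ i) \<partial>count_space UNIV) = (\<Sum>i\<in>UNIV. ennreal (p $ i))"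
    by (simp add: nn_integral_count_space_finite)
  also have "\<dots> = ennreal (\<Sum>i\<in>UNIV. p $ i)"
    using assms by (intro sum_ennreal) (auto simp: prob_simplex_nonneg_iff)
  finally show "(\<integral>\<^sup>+ i. ennreal (p $ i) \<partial>count_space UNIV) = 1"
    using assms by (simp add: prob_simplex_nonneg_iff)
qed (use assms in \<open>auto simp: prob_simplex_nonneg_iff\<close>)

lemma pmf_toss_pmf:
  fixes p q :: "real ^ 'k::finite"
  assumes "p \<in> prob_simplex" "q \<in> prob_simplex" "0 \<le> \<mu>" "\<mu> \<le> 1"
  shows "pmf (toss_pmf \<mu> p q) (Blue, i) = \<mu> * p $ i"
    and "pmf (toss_pmf \<mu> p q) (Red, i) = (1 - \<mu>) * q $ i"
proof -
  have same: "pmf (map_pmf (Pair c) D) (c, i) = pmf D i" for c :: color and D :: "'k pmf"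
    by (rule pmf_map_inj') (auto simp: inj_on_def)
  have other: "pmf (map_pmf (Pair c) D) (d, i) = 0" if "c \<noteq> d" for c d :: color and D :: "'k pmf"
    using that by (auto simp: pmf_eq_0_set_pmf)
  show "pmf (toss_pmf \<mu> p q) (Blue, i) = \<mu> * p $ i"
    "pmf (toss_pmf \<mu> p q) (Red, i) = (1 - \<mu>) * q $ i"
    using assms
    by (simp_all add: toss_pmf_def color_pmf_def pmf_bind same other pmf_die_pmf)
qed

text \<open>
  The law of the whole sequence of colors and sides. The tosses are numbered from 0, so the first
  \<open>n\<close> tosses are those with index below \<open>n\<close>.
\<close>

definition dice_process ::
    "real \<Rightarrow> real ^ 'k::finite \<Rightarrow> real ^ 'k \<Rightarrow> (nat \<Rightarrow> color \<times> 'k) measure" where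
  "dice_process \<mu> p q = (\<Pi>\<^sub>M t\<in>UNIV. measure_pmf (toss_pmf \<mu> p q))"

definition observations :: "nat \<Rightarrow> (nat \<Rightarrow> color \<times> 'k) \<Rightarrow> (color \<times> 'k) list" where
  "observations n \<omega> = map \<omega> [0..<n]"

definition likelihood :: "color \<Rightarrow> (color \<times> 'k) list \<Rightarrow> real ^ 'k::finite \<Rightarrow> real" where
  "likelihood c xs p = (\<Prod>i\<in>UNIV. (p $ i) ^ count_list xs (c, i))"

definition posterior_density ::
    "color \<Rightarrow> (real ^ 'k::finite \<Rightarrow> real) \<Rightarrow> (color \<times> 'k) list \<Rightarrow> real ^ 'k \<Rightarrow> real" where
  "posterior_density c f xs p =
     likelihood c xs p * f p / (\<integral>s. likelihood c xs s * f s \<partial>simplex_lebesgue)"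

text \<open>
  Odds of blue against red for a further toss that landed on side \<open>k\<close> with its color unobserved.
\<close>

definition posterior_odds ::
    "real \<Rightarrow> real \<Rightarrow> (real ^ 'k::finite \<Rightarrow> real) \<Rightarrow> (real ^ 'k \<Rightarrow> real) \<Rightarrow> 'k \<Rightarrow>
     (color \<times> 'k) list \<Rightarrow> real" where
  "posterior_odds \<mu>B \<mu>R \<pi> \<rho> k xs =
     (\<mu>B * (\<integral>p. p $ k * posterior_density Blue \<pi> xs p \<partial>simplex_lebesgue)) /
     (\<mu>R * (\<integral>q. q $ k * posterior_density Red \<rho> xs q \<partial>simplex_lebesgue))"

end

theory Submission
  imports Defs
begin

text \<open>
  Condition P writes a prior density as \<open>h\<close> times the unnormalized Dirichlet density with parameter
  \<open>\<alpha>\<close>, where \<open>h\<close> is uniformly continuous and bounded below by a positive constant. After counts \<open>y\<close> with total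
  \<open>N\<close>, the posterior mean of coordinate \<open>k\<close> is the Dirichlet value \<open>(\<alpha>\<^sub>k + y\<^sub>k) / (|\<alpha>| + N)\<close> times
  the quotient of the expectations of \<open>h\<close> under the Dirichlet laws with parameters \<open>\<alpha> + y + e\<^sub>k\<close> and
  \<open>\<alpha> + y\<close>. Both laws have total variance at most \<open>1 / (|\<alpha>| + N)\<close> and means at distance at most
  \<open>2 / (|\<alpha>| + N)\<close>, so this quotient tends to 1 as \<open>N\<close> grows, uniformly in \<open>y\<close>.

  By Chebyshev's inequality, with high probability the number of tosses of each color and the
  number of blue tosses showing side \<open>k\<close> are close to their means, while the number of red tosses
  showing it is at most slightly above \<open>n \<mu>\<^sub>R p\<^sub>k\<close>. All error bounds only
  depend on \<open>n p\<^sub>k\<close>. Then the blue posterior mean is at least \<open>p\<^sub>k\<close> and the red one at most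
  \<open>p\<^sub>k\<close>, up to factors close to 1.
\<close>

section \<open>Dirichlet integrals over the simplex\<close>

text \<open>Substituting \<open>x = t * u\<close> gives Euler's Beta integral on the unit interval,
  and the powers of \<open>t\<close> collect in front. This is the one-coordinate step of the
  Dirichlet integral below.\<close>

lemma nn_integral_Beta_scaled:
  fixes a b t :: real
  assumes "0 < a" "0 < b"
  shows "(\<integral>\<^sup>+x. ennreal (if 0 < x \<and> x < t then x powr (a - 1) * (t - x) powr (b - 1) else 0) \<partial>lborel) =
    ennreal (if 0 < t then Beta a b * t powr (a + b - 1) else 0)"
proof (cases "0 < t")
  case True
  let ?f = "\<lambda>x::real. if 0 < x \<and> x < t then x powr (a - 1) * (t - x) powr (b - 1) else 0"
  have "(\<integral>\<^sup>+x. ennreal (?f x) \<partial>lborel) = \<bar>t\<bar> * (\<integral>\<^sup>+x. ennreal (?f (0 + t * x)) \<partial>lborel)"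
    using True by (intro nn_integral_real_affine) auto
  also have "(\<integral>\<^sup>+x. ennreal (?f (0 + t * x)) \<partial>lborel) =
      (\<integral>\<^sup>+x. ennreal (t powr (a + b - 2)) * (ennreal (x powr (a - 1) * (1 - x) powr (b - 1)) * indicator {0..1} x) \<partial>lborel)"
  proof (rule nn_integral_cong)
    fix x :: real
    have "t * x < t \<longleftrightarrow> x < 1" "0 < t * x \<longleftrightarrow> 0 < x" using True by (auto simp: zero_less_mult_iff)
    moreover have "(t * x) powr (a - 1) * (t - t * x) powr (b - 1) =
        t powr (a + b - 2) * (x powr (a - 1) * (1 - x) powr (b - 1))" if "0 < x" "x < 1"
    proof -
      have "t - t * x = t * (1 - x)" by (simp add: algebra_simps)
      then have "(t * x) powr (a - 1) * (t - t * x) powr (b - 1) =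
        (t powr (a - 1) * t powr (b - 1)) * (x powr (a - 1) * (1 - x) powr (b - 1))"
        using that True by (simp add: powr_mult)
      also have "t powr (a - 1) * t powr (b - 1) = t powr (a + b - 2)"
        by (simp add: powr_add[symmetric])
      finally show ?thesis .
    qed
    \<comment> \<open>The closed interval in the indicator agrees with the strict conditions in
      \<open>?f\<close>: at either endpoint a factor of the form \<open>0 powr _\<close> makes the
      integrand 0.\<close>
    ultimately show "ennreal (?f (0 + t * x)) =
      ennreal (t powr (a + b - 2)) * (ennreal (x powr (a - 1) * (1 - x) powr (b - 1)) * indicator {0..1} x)"
      by (auto simp: indicator_def ennreal_mult' split: if_splits)
  qed
  also have "\<dots> = ennreal (t powr (a + b - 2)) * ennreal (Beta a b)"
    by (subst nn_integral_cmult)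
       (use nn_integral_has_integral_lebesgue'[OF _ has_integral_Beta_real[OF assms]] in auto)
  also have "ennreal \<bar>t\<bar> * (ennreal (t powr (a + b - 2)) * ennreal (Beta a b)) =
      ennreal (t * t powr (a + b - 2) * Beta a b)"
    using True assms by (simp add: ennreal_mult'' ennreal_mult' mult.assoc)
  also have "t * t powr (a + b - 2) = t powr (a + b - 1)"
    using True by (simp add: powr_mult_base)
  finally show ?thesis using True by (simp add: mult.commute)
qed (auto intro!: nn_integral_zero' AE_I2)

text \<open>The factor \<open>(t - sum x A) powr (b - 1)\<close> carries the exponent of the coordinate that the chart
  omits; leaving \<open>t\<close> free is what lets the induction on \<open>A\<close> go through.\<close>

lemma nn_integral_Dirichlet:
  fixes \<beta> :: "'a \<Rightarrow> real" and b t :: real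
  assumes "finite A" "\<And>i. i \<in> A \<Longrightarrow> 0 < \<beta> i" "0 < b"
  shows "(\<integral>\<^sup>+x. ennreal (if (\<forall>i\<in>A. 0 < x i) \<and> sum x A < t
        then (\<Prod>i\<in>A. x i powr (\<beta> i - 1)) * (t - sum x A) powr (b - 1) else 0) \<partial>(\<Pi>\<^sub>M i\<in>A. lborel)) =
    ennreal (if 0 < t then (\<Prod>i\<in>A. Gamma (\<beta> i)) * Gamma b / Gamma (sum \<beta> A + b) *
      t powr (sum \<beta> A + b - 1) else 0)"
  using assms(1,2)
proof (induction arbitrary: t rule: finite_induct)
  case empty
  then show ?case using Gamma_real_pos[OF \<open>0 < b\<close>] by (simp add: PiM_empty)
next
  case (insert a A)
  let ?M = "\<lambda>A::'a set. \<Pi>\<^sub>M i\<in>A. (lborel :: real measure)"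
  define F where "F A t x = (if (\<forall>i\<in>A. 0 < x i) \<and> sum x A < t
        then (\<Prod>i\<in>A. x i powr (\<beta> i - 1)) * (t - sum x A) powr (b - 1) else 0)" for A t and x :: "'a \<Rightarrow> real"
  have F_meas [measurable]: "F A t \<in> borel_measurable (?M A)" if "finite A" for A t
    unfolding F_def using that by measurable
  let ?s = "sum \<beta> A + b"
  define C where "C = (\<Prod>i\<in>A. Gamma (\<beta> i)) * Gamma b / Gamma ?s"
  have s: "0 < ?s" using insert.prems \<open>0 < b\<close> by (intro add_nonneg_pos sum_nonneg) (auto intro: less_imp_le)
  have C: "0 \<le> C" unfolding C_def using insert.prems s \<open>0 < b\<close>
    by (intro divide_nonneg_pos mult_nonneg_nonneg prod_nonneg) (auto intro: less_imp_le Gamma_real_pos)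
  \<comment> \<open>Fixing the new coordinate at \<open>y\<close> leaves the same kind of integrand
    in the other coordinates, with \<open>t - y\<close> in place of \<open>t\<close>.\<close>
  have split: "F (insert a A) t (x(a := y)) = (if 0 < y then y powr (\<beta> a - 1) else 0) * F A (t - y) x" for x y
  proof -
    have "sum (x(a := y)) A = sum x A" "(\<Prod>i\<in>A. (x(a := y)) i powr (\<beta> i - 1)) = (\<Prod>i\<in>A. x i powr (\<beta> i - 1))"
      "(\<forall>i\<in>A. 0 < (x(a := y)) i) = (\<forall>i\<in>A. 0 < x i)"
      using insert.hyps by (auto intro!: sum.cong prod.cong)
    then show ?thesis
      unfolding F_def using insert.hyps by (auto simp: algebra_simps)
  qed
  interpret product_sigma_finite "\<lambda>_::'a. lborel :: real measure" by standard
  have "(\<integral>\<^sup>+x. ennreal (F (insert a A) t x) \<partial>?M (insert a A)) =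
      (\<integral>\<^sup>+y. \<integral>\<^sup>+x. ennreal (F (insert a A) t (x(a := y))) \<partial>?M A \<partial>lborel)"
    using insert.hyps by (intro product_nn_integral_insert_rev) auto
  also have "\<dots> = (\<integral>\<^sup>+y. ennreal (if 0 < y then y powr (\<beta> a - 1) else 0) * (\<integral>\<^sup>+x. ennreal (F A (t - y) x) \<partial>?M A) \<partial>lborel)"
    unfolding split using insert.hyps
    by (subst nn_integral_cmult[symmetric]) (auto simp: ennreal_mult')
  \<comment> \<open>By the induction hypothesis at \<open>t - y\<close> the inner integral is
    \<open>C * (t - y) powr (?s - 1)\<close> for \<open>y < t\<close> and 0 otherwise, so a scaled
    Beta integral in \<open>y\<close> remains.\<close>
  also have "\<dots> = (\<integral>\<^sup>+y. ennreal C * ennreal (if 0 < y \<and> y < t then y powr (\<beta> a - 1) * (t - y) powr (?s - 1) else 0) \<partial>lborel)"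
    using insert.IH insert.prems C unfolding F_def C_def[symmetric]
    by (intro nn_integral_cong) (auto simp: ennreal_mult'[symmetric] ennreal_mult''[symmetric] mult_ac)
  also have "\<dots> = ennreal C * ennreal (if 0 < t then Beta (\<beta> a) ?s * t powr (\<beta> a + ?s - 1) else 0)"
    using insert.prems s by (subst nn_integral_cmult) (auto simp: nn_integral_Beta_scaled)
  also have "\<dots> = ennreal (if 0 < t then (\<Prod>i\<in>insert a A. Gamma (\<beta> i)) * Gamma b / Gamma (sum \<beta> (insert a A) + b) *
      t powr (sum \<beta> (insert a A) + b - 1) else 0)"
  proof -
    have "Gamma ?s \<noteq> 0" using Gamma_real_pos[OF s] by simp
    then have "C * Beta (\<beta> a) ?s = (\<Prod>i\<in>insert a A. Gamma (\<beta> i)) * Gamma b / Gamma (sum \<beta> (insert a A) + b)"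
      using insert.hyps by (simp add: C_def Beta_def add_ac)
    then show ?thesis
      using insert.hyps C by (auto simp: ennreal_mult'[symmetric] add_ac simp flip: mult.assoc)
  qed
  finally show ?case by (simp add: F_def)
qed

text \<open>Since \<open>0 powr x = 0\<close> even for \<open>x = 0\<close>, this weight vanishes on the whole boundary of the simplex.\<close>

definition dirichlet_weight :: "real ^ 'k::finite \<Rightarrow> real ^ 'k \<Rightarrow> real" where
  "dirichlet_weight \<beta> p = (\<Prod>i\<in>UNIV. p $ i powr (\<beta> $ i - 1))"

definition dirichlet_const :: "real ^ 'k::finite \<Rightarrow> real" where
  "dirichlet_const \<beta> = (\<Prod>i\<in>UNIV. Gamma (\<beta> $ i)) / Gamma (\<Sum>i\<in>UNIV. \<beta> $ i)"

lemma dirichlet_weight_nonneg: "0 \<le> dirichlet_weight \<beta> p"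
  by (auto simp: dirichlet_weight_def intro: prod_nonneg)

lemma measurable_vec_nth [measurable]: "(\<lambda>p::real^'k::finite. p $ i) \<in> borel_measurable borel"
  by (intro borel_measurable_continuous_onI continuous_intros)

lemma borel_measurable_simplex_lebesgue:
  assumes "f \<in> borel_measurable borel"
  shows "f \<in> borel_measurable simplex_lebesgue"
  unfolding simplex_lebesgue_def
  by (intro measurable_completion measurable_restrict_space1) (use assms in simp)

lemma dirichlet_weight_borel [measurable]: "dirichlet_weight \<beta> \<in> borel_measurable borel"
  unfolding dirichlet_weight_def by measurable

text \<open>Pulled back along the chart, the omitted coordinate becomes \<open>1 - sum x\<close>,
  and the weight turns into the integrand of \<open>nn_integral_Dirichlet\<close> at
  \<open>t = 1\<close>.\<close>

lemma nn_integral_dirichlet_weight: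
  fixes \<beta> :: "real ^ 'k::finite"
  assumes "\<And>i. 0 < \<beta> $ i"
  shows "(\<integral>\<^sup>+p. ennreal (dirichlet_weight \<beta> p) \<partial>simplex_lebesgue) = ennreal (dirichlet_const \<beta>)"
proof -
  let ?o = "omitted :: 'k"
  let ?M = "\<Pi>\<^sub>M i\<in>-{?o}. (lborel :: real measure)"
  have U: "(UNIV :: 'k set) = insert ?o (-{?o})" by auto
  have prod_U: "prod f (UNIV :: 'k set) = f ?o * prod f (-{?o})" for f :: "'k \<Rightarrow> real"
    by (subst U, subst prod.insert) auto
  have sum_U: "sum f (UNIV :: 'k set) = f ?o + sum f (-{?o})" for f :: "'k \<Rightarrow> real"
    by (subst U, subst sum.insert) auto
  have "(\<integral>\<^sup>+p. ennreal (dirichlet_weight \<beta> p) \<partial>simplex_lebesgue) =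
      (\<integral>\<^sup>+p. ennreal (dirichlet_weight \<beta> p) * indicator prob_simplex p \<partial>distr ?M borel hyperplane_chart)"
    unfolding simplex_lebesgue_def nn_integral_completion
    by (subst nn_integral_restrict_space) auto
  also have "\<dots> = (\<integral>\<^sup>+x. ennreal (dirichlet_weight \<beta> (hyperplane_chart x)) *
      indicator prob_simplex (hyperplane_chart x) \<partial>?M)"
    by (subst nn_integral_distr) auto
  also have "\<dots> = (\<integral>\<^sup>+x. ennreal (if (\<forall>i\<in>-{?o}. 0 < x i) \<and> sum x (-{?o}) < 1
        then (\<Prod>i\<in>-{?o}. x i powr (\<beta> $ i - 1)) * (1 - sum x (-{?o})) powr (\<beta> $ ?o - 1) else 0) \<partial>?M)"
  proof (rule nn_integral_cong)
    fix x :: "'k \<Rightarrow> real"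
    let ?c = "hyperplane_chart x"
    have w: "dirichlet_weight \<beta> ?c = (1 - sum x (-{?o})) powr (\<beta> $ ?o - 1) * (\<Prod>i\<in>-{?o}. x i powr (\<beta> $ i - 1))"
      unfolding dirichlet_weight_def prod_U by (simp add: hyperplane_chart_def)
    have sum1: "(\<Sum>i\<in>UNIV. ?c $ i) = 1"
      unfolding sum_U by (simp add: hyperplane_chart_def)
    have mem: "?c \<in> prob_simplex \<longleftrightarrow> (\<forall>i\<in>-{?o}. 0 \<le> x i) \<and> sum x (-{?o}) \<le> 1"
      using sum1 by (auto simp: prob_simplex_nonneg_iff hyperplane_chart_def)
    \<comment> \<open>The simplex is closed, while the Dirichlet integrand lives on an open region.
      The last two cases are the boundary points, where a chart coordinate or the omitted coordinate
      is 0 and the weight vanishes.\<close>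
    consider "(\<forall>i\<in>-{?o}. 0 < x i) \<and> sum x (-{?o}) < 1" | "?c \<notin> prob_simplex"
      | "\<not> ((\<forall>i\<in>-{?o}. 0 < x i) \<and> sum x (-{?o}) < 1)" "\<exists>i\<in>-{?o}. x i = 0" |
        "\<not> ((\<forall>i\<in>-{?o}. 0 < x i) \<and> sum x (-{?o}) < 1)" "sum x (-{?o}) = 1"
      unfolding mem by force
    then show "ennreal (dirichlet_weight \<beta> ?c) * indicator prob_simplex ?c =
      ennreal (if (\<forall>i\<in>-{?o}. 0 < x i) \<and> sum x (-{?o}) < 1
        then (\<Prod>i\<in>-{?o}. x i powr (\<beta> $ i - 1)) * (1 - sum x (-{?o})) powr (\<beta> $ ?o - 1) else 0)"
    proof cases
      case 1
      then have "?c \<in> prob_simplex" unfolding mem by (auto intro: less_imp_le)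
      with 1 show ?thesis unfolding w by (simp add: mult.commute)
    next
      case 2
      then have "\<not> ((\<forall>i\<in>-{?o}. 0 < x i) \<and> sum x (-{?o}) < 1)" unfolding mem by (auto intro: less_imp_le)
      with 2 show ?thesis by auto
    next
      case 3
      then have "dirichlet_weight \<beta> ?c = 0" unfolding w by (auto intro!: prod_zero)
      then show ?thesis unfolding if_not_P[OF 3(1)] by simp
    next
      case 4
      then show ?thesis unfolding w by auto
    qed
  qed
  also have "\<dots> = ennreal (dirichlet_const \<beta>)"
    using assms by (subst nn_integral_Dirichlet) (auto simp: dirichlet_const_def prod_U sum_U ac_simps)
  finally show ?thesis .
qed

text \<open>With all parameters equal to 1 the weight is the indicator of the interior, because
  \<open>0 powr 0 = 0\<close>. Its integral \<open>1 / Gamma K\<close> is the total mass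
  \<open>1 / (K - 1)!\<close>, so the boundary is a null set.\<close>

lemma AE_simplex_interior:
  "AE p in (simplex_lebesgue :: (real ^ 'k::finite) measure). p \<in> rel_interior prob_simplex"
proof -
  let ?M = "simplex_lebesgue :: (real ^ 'k) measure"
  let ?I = "{p \<in> space ?M. \<forall>i. 0 < p $ i}"
  have I_sets: "?I \<in> sets ?M"
    using borel_measurable_simplex_lebesgue[OF measurable_vec_nth] by measurable
  have "dirichlet_weight 1 p = indicator ?I p" if "p \<in> space ?M" for p :: "real^'k"
    using that
    by (auto simp: dirichlet_weight_def indicator_def prob_simplex_nonneg_iff order_less_le powr_zero_eq_one
        split: if_splits)
  then have "(\<integral>\<^sup>+p. ennreal (dirichlet_weight 1 p) \<partial>?M) = (\<integral>\<^sup>+p. indicator ?I p \<partial>?M)"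
    by (intro nn_integral_cong) (simp add: ennreal_indicator)
  then have "emeasure ?M ?I = (\<integral>\<^sup>+p. ennreal (dirichlet_weight 1 p) \<partial>?M)"
    using I_sets by simp
  also have "\<dots> = ennreal (1 / Gamma (CARD('k)))"
    by (subst nn_integral_dirichlet_weight) (auto simp: dirichlet_const_def)
  also have "Gamma (real CARD('k)) = fact (CARD('k) - 1)"
    using Gamma_fact[of "CARD('k) - 1", where ?'a = real] by simp
  finally have "emeasure ?M ?I = emeasure ?M (space ?M)"
    by (simp add: emeasure_simplex_lebesgue)
  then have "emeasure ?M (space ?M - ?I) = 0"
    using I_sets sets.top[of ?M] by (subst emeasure_Diff) (auto simp: emeasure_simplex_lebesgue)
  then have "AE p in ?M. \<not> p \<in> space ?M - ?I"
    using I_sets sets.top[of ?M] by (intro AE_not_in null_setsI) auto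
  then show ?thesis
    using AE_space by eventually_elim (auto simp: rel_interior_prob_simplex)
qed

section \<open>Concentration of Dirichlet laws\<close>

lemma dirichlet_const_pos:
  assumes "\<And>i. 0 < \<beta> $ i"
  shows "0 < dirichlet_const \<beta>"
  unfolding dirichlet_const_def
  by (intro divide_pos_pos prod_pos Gamma_real_pos sum_pos) (use assms in auto)

text \<open>The functional equation of Gamma, used in the \<open>k\<close>-th factor and in the
  Gamma of the total. Together with \<open>dirichlet_weight_add_axis\<close> it yields the moments
  of Dirichlet laws.\<close>

lemma dirichlet_const_add_axis:
  fixes \<beta> :: "real ^ 'k::finite"
  assumes "\<And>i. 0 < \<beta> $ i"
  shows "dirichlet_const (\<beta> + axis k 1) = \<beta> $ k / (\<Sum>i\<in>UNIV. \<beta> $ i) * dirichlet_const \<beta>"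
proof -
  have G: "Gamma (x + 1) = x * Gamma x" if "0 < x" for x :: real
    using that by (intro Gamma_plus1) (auto elim!: nonpos_Ints_cases)
  let ?s = "\<Sum>i\<in>UNIV. \<beta> $ i"
  have s: "0 < ?s" using assms by (intro sum_pos) auto
  have "(\<Sum>i\<in>UNIV. (\<beta> + axis k 1) $ i) = ?s + 1"
    by (simp add: sum.distrib axis_def)
  moreover have "(\<Prod>i\<in>UNIV. Gamma ((\<beta> + axis k 1) $ i)) = \<beta> $ k * (\<Prod>i\<in>UNIV. Gamma (\<beta> $ i))"
  proof -
    have "(\<Prod>i\<in>UNIV - {k}. Gamma ((\<beta> + axis k 1) $ i)) = (\<Prod>i\<in>UNIV - {k}. Gamma (\<beta> $ i))"
      by (rule prod.cong) (auto simp: axis_def)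
    then show ?thesis
      using G[OF assms] by (subst (1 2) prod.remove[of _ k]) (auto simp: axis_def)
  qed
  ultimately show ?thesis
    using G[OF s] s by (simp add: dirichlet_const_def)
qed

lemma dirichlet_weight_add_axis:
  fixes \<beta> :: "real ^ 'k::finite"
  assumes "p \<in> prob_simplex"
  shows "dirichlet_weight (\<beta> + axis k 1) p = p $ k * dirichlet_weight \<beta> p"
proof -
  have "(\<Prod>i\<in>UNIV - {k}. p $ i powr ((\<beta> + axis k 1) $ i - 1)) = (\<Prod>i\<in>UNIV - {k}. p $ i powr (\<beta> $ i - 1))"
    by (rule prod.cong) (auto simp: axis_def)
  moreover have "p $ k powr ((\<beta> + axis k 1) $ k - 1) = p $ k * p $ k powr (\<beta> $ k - 1)"
  proof (cases "p $ k = 0")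
    case False
    then have "0 < p $ k" using assms by (auto simp: prob_simplex_nonneg_iff order_less_le)
    then show ?thesis by (simp add: axis_def powr_mult_base)
  qed simp
  ultimately show ?thesis
    unfolding dirichlet_weight_def by (subst (1 2) prod.remove[of _ k]) auto
qed

lemma
  fixes \<beta> :: "real ^ 'k::finite"
  assumes "\<And>i. 0 < \<beta> $ i"
  shows integrable_dirichlet_weight: "integrable simplex_lebesgue (dirichlet_weight \<beta>)"
    and integral_dirichlet_weight: "(\<integral>p. dirichlet_weight \<beta> p \<partial>simplex_lebesgue) = dirichlet_const \<beta>"
proof -
  have "integrable simplex_lebesgue (dirichlet_weight \<beta>) \<and>
      (\<integral>p. dirichlet_weight \<beta> p \<partial>simplex_lebesgue) = dirichlet_const \<beta>"
    using nn_integral_dirichlet_weight[OF assms] dirichlet_const_pos[OF assms]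
    by (subst nn_integral_eq_integrable[symmetric])
       (auto simp: dirichlet_weight_nonneg intro: borel_measurable_simplex_lebesgue less_imp_le)
  then show "integrable simplex_lebesgue (dirichlet_weight \<beta>)"
    "(\<integral>p. dirichlet_weight \<beta> p \<partial>simplex_lebesgue) = dirichlet_const \<beta>" by auto
qed

text \<open>Condition P controls the quotient \<open>h\<close> only on the interior; a bound there
  is enough since the boundary is null.\<close>

lemma integrable_dirichlet_weight_mult:
  fixes \<beta> :: "real ^ 'k::finite" and h :: "real ^ 'k \<Rightarrow> real"
  assumes "\<And>i. 0 < \<beta> $ i" "h \<in> borel_measurable simplex_lebesgue"
    and "\<And>p. p \<in> rel_interior prob_simplex \<Longrightarrow> \<bar>h p\<bar> \<le> M"
  shows "integrable simplex_lebesgue (\<lambda>p. dirichlet_weight \<beta> p * h p)"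
proof (rule Bochner_Integration.integrable_bound)
  show "integrable simplex_lebesgue (\<lambda>p. M * dirichlet_weight \<beta> p)"
    using integrable_dirichlet_weight[OF assms(1)] by simp
  show "(\<lambda>p. dirichlet_weight \<beta> p * h p) \<in> borel_measurable simplex_lebesgue"
    using assms(2) borel_measurable_simplex_lebesgue[OF dirichlet_weight_borel] by measurable
  show "AE p in simplex_lebesgue. norm (dirichlet_weight \<beta> p * h p) \<le> norm (M * dirichlet_weight \<beta> p)"
    using AE_simplex_interior
  proof eventually_elim
    case (elim p)
    have "norm (dirichlet_weight \<beta> p * h p) = dirichlet_weight \<beta> p * \<bar>h p\<bar>"
      by (simp add: abs_mult dirichlet_weight_nonneg)
    also have "\<dots> \<le> dirichlet_weight \<beta> p * M"
      by (intro mult_left_mono assms(3) elim dirichlet_weight_nonneg)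
    also have "\<dots> \<le> norm (M * dirichlet_weight \<beta> p)" by (simp add: mult.commute)
    finally show ?case .
  qed
qed

definition dirichlet_mean :: "real ^ 'k::finite \<Rightarrow> real ^ 'k" where
  "dirichlet_mean \<beta> = (1 / (\<Sum>i\<in>UNIV. \<beta> $ i)) *\<^sub>R \<beta>"

lemma dirichlet_mean_interior:
  fixes \<beta> :: "real ^ 'k::finite"
  assumes "\<And>i. 0 < \<beta> $ i"
  shows "dirichlet_mean \<beta> \<in> rel_interior prob_simplex"
proof -
  have "0 < (\<Sum>i\<in>UNIV. \<beta> $ i)" using assms by (intro sum_pos) auto
  then show ?thesis
    using assms
    by (auto simp: rel_interior_prob_simplex prob_simplex_nonneg_iff dirichlet_mean_def
        sum_divide_distrib[symmetric] less_imp_le)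
qed

lemma norm_prob_simplex_le:
  assumes "p \<in> prob_simplex"
  shows "norm p \<le> 1"
  using norm_le_l1_cart[of p] assms by (simp add: prob_simplex_nonneg_iff)

text \<open>The new mean is a convex combination of the old mean and the vertex
  \<open>axis k 1\<close>, with weight \<open>1 / (s + 1)\<close> on the vertex, where
  \<open>s\<close> is the total parameter. Both points lie in the unit ball.\<close>

lemma dirichlet_mean_add_axis:
  fixes \<beta> :: "real ^ 'k::finite"
  assumes "\<And>i. 0 < \<beta> $ i"
  shows "norm (dirichlet_mean (\<beta> + axis k 1) - dirichlet_mean \<beta>) \<le> 2 / ((\<Sum>i\<in>UNIV. \<beta> $ i) + 1)"
proof -
  let ?s = "\<Sum>i\<in>UNIV. \<beta> $ i"
  have s: "0 < ?s" using assms by (intro sum_pos) auto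
  have sum: "(\<Sum>i\<in>UNIV. (\<beta> + axis k 1) $ i) = ?s + 1"
    by (simp add: sum.distrib axis_def)
  have "dirichlet_mean (\<beta> + axis k 1) - dirichlet_mean \<beta> = (1 / (?s + 1)) *\<^sub>R (axis k 1 - dirichlet_mean \<beta>)"
  proof -
    have "(b + e) / (u + 1) - b / u = (e - b / u) / (u + 1)" if "0 < u" for b e u :: real
    proof -
      have "u + 1 \<noteq> 0" using that by simp
      then show ?thesis using that by (simp add: field_simps)
    qed
    from this[OF s] show ?thesis
      unfolding dirichlet_mean_def sum by (simp add: vec_eq_iff add_divide_distrib)
  qed
  moreover have "norm (axis k 1 - dirichlet_mean \<beta>) \<le> 1 + 1"
    using norm_prob_simplex_le[of "dirichlet_mean \<beta>"] dirichlet_mean_interior[OF assms]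
    by (intro norm_triangle_le_diff) (auto simp: rel_interior_prob_simplex)
  ultimately show ?thesis
    using s by (simp add: divide_right_mono)
qed

text \<open>Expanding the square coordinatewise leaves Dirichlet weights with one parameter raised
  by 0, 1 or 2, whose integrals are known. With mean \<open>m\<close> and total parameter
  \<open>s\<close>, coordinate \<open>i\<close> has variance
  \<open>m $ i * (1 - m $ i) / (s + 1)\<close>.\<close>

lemma dirichlet_variance:
  fixes \<beta> :: "real ^ 'k::finite"
  assumes "\<And>i. 0 < \<beta> $ i"
  shows "integrable simplex_lebesgue (\<lambda>p. dirichlet_weight \<beta> p * (norm (p - dirichlet_mean \<beta>))\<^sup>2)" (is ?int)
    and "(\<integral>p. dirichlet_weight \<beta> p * (norm (p - dirichlet_mean \<beta>))\<^sup>2 \<partial>simplex_lebesgue)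
      \<le> dirichlet_const \<beta> / ((\<Sum>i\<in>UNIV. \<beta> $ i) + 1)" (is ?le)
proof -
  let ?M = "simplex_lebesgue :: (real ^ 'k) measure"
  let ?s = "\<Sum>i\<in>UNIV. \<beta> $ i"
  let ?m = "dirichlet_mean \<beta>"
  let ?e = "\<lambda>i. axis i 1 :: real ^ 'k"
  have s: "0 < ?s" using assms by (intro sum_pos) auto
  have pos1: "0 < (\<beta> + ?e i) $ j" for i j
    using assms by (auto simp: axis_def add_pos_nonneg)
  define \<gamma> where "\<gamma> i = \<beta> + ?e i + ?e i" for i
  have pos2: "0 < (\<gamma> i) $ j" for i j
    unfolding \<gamma>_def by (subst vector_add_component, rule add_pos_nonneg[OF pos1]) (simp add: axis_def)
  have sum1: "(\<Sum>j\<in>UNIV. (\<beta> + ?e i) $ j) = ?s + 1" for i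
    by (simp add: sum.distrib axis_def)
  define V where "V i p = dirichlet_weight (\<gamma> i) p - 2 * ?m $ i * dirichlet_weight (\<beta> + ?e i) p
      + (?m $ i)\<^sup>2 * dirichlet_weight \<beta> p" for i p
  have expand: "dirichlet_weight \<beta> p * (norm (p - ?m))\<^sup>2 = (\<Sum>i\<in>UNIV. V i p)" if "p \<in> space ?M" for p
  proof -
    have "(norm (p - ?m))\<^sup>2 = (\<Sum>i\<in>UNIV. (p $ i - ?m $ i)\<^sup>2)"
      by (simp add: norm_vec_def L2_set_def sum_nonneg)
    moreover have "V i p = dirichlet_weight \<beta> p * (p $ i - ?m $ i)\<^sup>2" for i
    proof -
      have "p \<in> prob_simplex" using that by simp
      then show ?thesis
        unfolding V_def \<gamma>_def dirichlet_weight_add_axis[OF \<open>p \<in> prob_simplex\<close>]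
        by (simp add: power2_eq_square algebra_simps)
    qed
    ultimately show ?thesis by (simp add: sum_distrib_left)
  qed
  have V_int: "integrable ?M (V i)" for i
    unfolding V_def using integrable_dirichlet_weight[OF assms] integrable_dirichlet_weight[OF pos1]
      integrable_dirichlet_weight[OF pos2] by auto
  have V_le: "(\<integral>p. V i p \<partial>?M) \<le> dirichlet_const \<beta> / (?s + 1) * ?m $ i" for i
  proof -
    have "(\<integral>p. V i p \<partial>?M) = dirichlet_const (\<gamma> i) - 2 * ?m $ i * dirichlet_const (\<beta> + ?e i)
        + (?m $ i)\<^sup>2 * dirichlet_const \<beta>"
      unfolding V_def using integrable_dirichlet_weight[OF assms] integrable_dirichlet_weight[OF pos1]
        integrable_dirichlet_weight[OF pos2]
      by (simp add: integral_dirichlet_weight[OF assms] integral_dirichlet_weight[OF pos1]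
        integral_dirichlet_weight[OF pos2])
    also have "\<dots> = ?m $ i * (1 - ?m $ i) / (?s + 1) * dirichlet_const \<beta>"
    proof -
      have c1: "dirichlet_const (\<beta> + ?e i) = ?m $ i * dirichlet_const \<beta>"
        using dirichlet_const_add_axis[OF assms, of i] by (simp add: dirichlet_mean_def)
      have c2: "dirichlet_const (\<gamma> i) = (\<beta> $ i + 1) / (?s + 1) * (?m $ i * dirichlet_const \<beta>)"
        using dirichlet_const_add_axis[OF pos1, of i i] unfolding \<gamma>_def sum1 c1 by (simp add: axis_def)
      have b: "\<beta> $ i = ?s * ?m $ i" using s by (simp add: dirichlet_mean_def)
      show ?thesis unfolding c1 c2 b using s by (simp add: field_simps power2_eq_square)
    qed
    \<comment> \<open>Dropping the negative square leaves a term proportional to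
      \<open>?m $ i\<close>; these coordinates sum to 1.\<close>
    also have "\<dots> \<le> ?m $ i / (?s + 1) * dirichlet_const \<beta>"
      using s dirichlet_const_pos[OF assms]
      by (intro mult_right_mono divide_right_mono) (auto simp: algebra_simps)
    finally show ?thesis by (simp add: mult.commute)
  qed
  show ?int
    using V_int by (subst Bochner_Integration.integrable_cong[OF refl expand]) auto
  have "(\<integral>p. dirichlet_weight \<beta> p * (norm (p - ?m))\<^sup>2 \<partial>?M) = (\<Sum>i\<in>UNIV. \<integral>p. V i p \<partial>?M)"
    using V_int by (subst Bochner_Integration.integral_cong[OF refl expand]) (auto simp: Bochner_Integration.integral_sum)
  also have "\<dots> \<le> (\<Sum>i\<in>UNIV. dirichlet_const \<beta> / (?s + 1) * ?m $ i)"
    by (intro sum_mono V_le)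
  also have "\<dots> = dirichlet_const \<beta> / (?s + 1)"
    unfolding sum_distrib_left[symmetric] using dirichlet_mean_interior[OF assms]
    by (simp add: rel_interior_prob_simplex prob_simplex_nonneg_iff)
  finally show ?le .
qed

text \<open>As in Bernstein's proof of the Weierstrass theorem, uniform continuity handles points
  near the mean, and the variance bound handles the rest. The threshold depends on \<beta> only
  through its total, which gives uniformity over all data.\<close>

lemma dirichlet_expectation_concentrates:
  fixes h :: "real ^ 'k::finite \<Rightarrow> real"
  assumes "h \<in> borel_measurable simplex_lebesgue" "uniformly_continuous_on (rel_interior prob_simplex) h"
    and M: "\<And>p. p \<in> rel_interior prob_simplex \<Longrightarrow> \<bar>h p\<bar> \<le> M" and "0 < \<eta>"
  shows "\<exists>S. \<forall>\<beta>. (\<forall>i. 0 < \<beta> $ i) \<longrightarrow> S \<le> (\<Sum>i\<in>UNIV. \<beta> $ i) \<longrightarrow>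
    \<bar>(\<integral>p. dirichlet_weight \<beta> p * h p \<partial>simplex_lebesgue) - h (dirichlet_mean \<beta>) * dirichlet_const \<beta>\<bar>
      \<le> \<eta> * dirichlet_const \<beta>"
proof -
  let ?I = "rel_interior (prob_simplex :: (real ^ 'k) set)"
  let ?M = "simplex_lebesgue :: (real ^ 'k) measure"
  obtain \<delta> where "0 < \<delta>" and \<delta>: "\<And>x y. x \<in> ?I \<Longrightarrow> y \<in> ?I \<Longrightarrow> dist x y < \<delta> \<Longrightarrow> dist (h x) (h y) < \<eta> / 2"
    using assms(2) \<open>0 < \<eta>\<close> unfolding uniformly_continuous_on_def by (metis half_gt_zero)
  have "0 \<le> M" using M[OF dirichlet_mean_interior[of 1]] by (simp add: abs_le_iff)
  \<comment> \<open>Chosen so that \<open>2 * M / \<delta>\<^sup>2\<close> times the variance bound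
    \<open>1 / (s + 1)\<close> is at most \<open>\<eta> / 2\<close> once the total \<open>s\<close>
    reaches \<open>S\<close>.\<close>
  define S where "S = 4 * M / (\<delta>\<^sup>2 * \<eta>)"
  have pointwise: "\<bar>h p - h m\<bar> \<le> \<eta> / 2 + 2 * M / \<delta>\<^sup>2 * (norm (p - m))\<^sup>2" if "p \<in> ?I" "m \<in> ?I" for p m
  proof (cases "norm (p - m) < \<delta>")
    case True
    then have "\<bar>h p - h m\<bar> \<le> \<eta> / 2" using \<delta>[OF that] by (simp add: dist_norm)
    moreover have "0 \<le> 2 * M / \<delta>\<^sup>2 * (norm (p - m))\<^sup>2" using \<open>0 \<le> M\<close> by simp
    ultimately show ?thesis by linarith
  next
    case False
    then have "\<delta>\<^sup>2 \<le> (norm (p - m))\<^sup>2" using \<open>0 < \<delta>\<close> by (intro power_mono) auto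
    then have "1 \<le> (norm (p - m))\<^sup>2 / \<delta>\<^sup>2" using \<open>0 < \<delta>\<close> by simp
    then have "2 * M * 1 \<le> 2 * M * ((norm (p - m))\<^sup>2 / \<delta>\<^sup>2)" using \<open>0 \<le> M\<close> by (intro mult_left_mono) auto
    moreover have "\<bar>h p - h m\<bar> \<le> 2 * M" using M[OF that(1)] M[OF that(2)] by linarith
    ultimately show ?thesis using \<open>0 < \<eta>\<close> by simp
  qed
  show ?thesis
  proof (intro exI[of _ S] allI impI)
    fix \<beta> :: "real ^ 'k" assume "\<forall>i. 0 < \<beta> $ i" and S: "S \<le> (\<Sum>i\<in>UNIV. \<beta> $ i)"
    let ?s = "\<Sum>i\<in>UNIV. \<beta> $ i"
    let ?m = "dirichlet_mean \<beta>" and ?w = "dirichlet_weight \<beta>" and ?B = "dirichlet_const \<beta>"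
    have pos: "0 < \<beta> $ i" for i using \<open>\<forall>i. 0 < \<beta> $ i\<close> by simp
    have s: "0 < ?s" using pos by (intro sum_pos) auto
    note m = dirichlet_mean_interior[OF pos] and B = dirichlet_const_pos[OF pos]
    note w_int = integrable_dirichlet_weight[OF pos]
    note wh_int = integrable_dirichlet_weight_mult[OF pos assms(1) M]
    note wv_int = dirichlet_variance(1)[OF pos]
    have diff_int: "integrable ?M (\<lambda>p. ?w p * (h p - h ?m))"
      using wh_int w_int by (simp add: right_diff_distrib)
    have "(\<integral>p. ?w p * h p \<partial>?M) - h ?m * ?B = (\<integral>p. ?w p * (h p - h ?m) \<partial>?M)"
      using wh_int w_int by (simp add: right_diff_distrib integral_dirichlet_weight[OF pos])
    also have "\<bar>\<dots>\<bar> \<le> (\<integral>p. \<bar>?w p * (h p - h ?m)\<bar> \<partial>?M)" by (rule integral_abs_bound)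
    also have "\<dots> \<le> (\<integral>p. \<eta> / 2 * ?w p + 2 * M / \<delta>\<^sup>2 * (?w p * (norm (p - ?m))\<^sup>2) \<partial>?M)"
    proof (rule integral_mono_AE)
      show "integrable ?M (\<lambda>p. \<bar>?w p * (h p - h ?m)\<bar>)" using diff_int by (rule integrable_abs)
      show "integrable ?M (\<lambda>p. \<eta> / 2 * ?w p + 2 * M / \<delta>\<^sup>2 * (?w p * (norm (p - ?m))\<^sup>2))"
        using w_int wv_int by auto
      show "AE p in ?M. \<bar>?w p * (h p - h ?m)\<bar> \<le> \<eta> / 2 * ?w p + 2 * M / \<delta>\<^sup>2 * (?w p * (norm (p - ?m))\<^sup>2)"
        using AE_simplex_interior
      proof eventually_elim
        case (elim p)
        have "\<bar>?w p * (h p - h ?m)\<bar> = ?w p * \<bar>h p - h ?m\<bar>" by (simp add: abs_mult dirichlet_weight_nonneg)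
        also have "\<dots> \<le> ?w p * (\<eta> / 2 + 2 * M / \<delta>\<^sup>2 * (norm (p - ?m))\<^sup>2)"
          by (intro mult_left_mono pointwise elim m dirichlet_weight_nonneg)
        also have "\<dots> = \<eta> / 2 * ?w p + 2 * M / \<delta>\<^sup>2 * (?w p * (norm (p - ?m))\<^sup>2)"
          by (simp add: algebra_simps)
        finally show ?case .
      qed
    qed
    also have "\<dots> = \<eta> / 2 * ?B + 2 * M / \<delta>\<^sup>2 * (\<integral>p. ?w p * (norm (p - ?m))\<^sup>2 \<partial>?M)"
      using w_int wv_int by (simp add: integral_dirichlet_weight[OF pos])
    also have "\<dots> \<le> \<eta> / 2 * ?B + 2 * M / \<delta>\<^sup>2 * (?B / (?s + 1))"
      using dirichlet_variance(2)[OF pos] \<open>0 \<le> M\<close> by (intro add_left_mono mult_left_mono) auto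
    also have "\<dots> \<le> \<eta> / 2 * ?B + \<eta> / 2 * ?B"
    proof (rule add_left_mono)
      have "4 * M \<le> ?s * (\<delta>\<^sup>2 * \<eta>)"
        using S \<open>0 < \<delta>\<close> \<open>0 < \<eta>\<close> unfolding S_def by (simp add: divide_le_eq)
      also have "\<dots> \<le> (?s + 1) * (\<delta>\<^sup>2 * \<eta>)"
        using \<open>0 < \<delta>\<close> \<open>0 < \<eta>\<close> by (intro mult_right_mono) auto
      finally have "2 * M \<le> \<eta> / 2 * (\<delta>\<^sup>2 * (?s + 1))" by (simp add: algebra_simps)
      moreover have "0 < \<delta>\<^sup>2 * (?s + 1)" using \<open>0 < \<delta>\<close> s by simp
      ultimately have "2 * M / \<delta>\<^sup>2 / (?s + 1) \<le> \<eta> / 2"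
        unfolding divide_divide_eq_left by (simp only: pos_divide_le_eq)
      then have "2 * M / \<delta>\<^sup>2 / (?s + 1) * ?B \<le> \<eta> / 2 * ?B"
        using B by (intro mult_right_mono) auto
      then show "2 * M / \<delta>\<^sup>2 * (?B / (?s + 1)) \<le> \<eta> / 2 * ?B" by simp
    qed
    finally show "\<bar>(\<integral>p. ?w p * h p \<partial>?M) - h ?m * ?B\<bar> \<le> \<eta> * ?B" by simp
  qed
qed

text \<open>Multiplying by a coordinate shifts the Dirichlet parameter by a unit vector, so the mean
  of a coordinate under the tilted density is the Dirichlet mean times a ratio of two expectations of
  \<open>h\<close> under Dirichlet laws that concentrate at nearly the same point.\<close>

lemma tilted_dirichlet_mean:
  fixes h :: "real ^ 'k::finite \<Rightarrow> real"
  assumes h_meas: "h \<in> borel_measurable simplex_lebesgue"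
    and h_uc: "uniformly_continuous_on (rel_interior prob_simplex) h"
    and c: "0 < c" "\<And>p. p \<in> rel_interior prob_simplex \<Longrightarrow> c \<le> h p" and "0 < \<eta>"
  shows "\<exists>S. \<forall>\<beta> k. (\<forall>i. 0 < \<beta> $ i) \<longrightarrow> S \<le> (\<Sum>i\<in>UNIV. \<beta> $ i) \<longrightarrow>
    \<bar>(\<integral>p. p $ k * (dirichlet_weight \<beta> p * h p) \<partial>simplex_lebesgue) /
      (\<integral>p. dirichlet_weight \<beta> p * h p \<partial>simplex_lebesgue) - dirichlet_mean \<beta> $ k\<bar>
      \<le> \<eta> * dirichlet_mean \<beta> $ k"
proof -
  let ?I = "rel_interior (prob_simplex :: (real ^ 'k) set)"
  let ?M = "simplex_lebesgue :: (real ^ 'k) measure"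
  \<comment> \<open>Condition P provides no upper bound on \<open>h\<close> directly; it follows
    from uniform continuity on a bounded set.\<close>
  have "bounded ?I"
    by (rule boundedI[of _ 1]) (auto simp: rel_interior_prob_simplex intro: norm_prob_simplex_le)
  then have "bounded (h ` ?I)" by (rule bounded_uniformly_continuous_image[OF h_uc])
  then obtain M where M: "\<And>p. p \<in> ?I \<Longrightarrow> \<bar>h p\<bar> \<le> M" by (auto simp: bounded_iff)
  \<comment> \<open>Three errors of size \<tau> will separate \<open>J'\<close> from
    \<open>J\<close>. The first entry keeps \<open>J\<close> above \<open>c / 2\<close>, and the
    second makes \<open>3 * \<tau>\<close> at most \<open>\<eta> * c / 2\<close>, hence at most
    \<open>\<eta> * J\<close>.\<close>
  define \<tau> where "\<tau> = min (c / 2) (\<eta> * c / 6)"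
  have \<tau>: "0 < \<tau>" "\<tau> \<le> c / 2" "\<tau> \<le> \<eta> * c / 6" using c(1) \<open>0 < \<eta>\<close> by (auto simp: \<tau>_def)
  obtain S where S: "\<And>\<beta>. (\<And>i. 0 < \<beta> $ i) \<Longrightarrow> S \<le> (\<Sum>i\<in>UNIV. \<beta> $ i) \<Longrightarrow>
    \<bar>(\<integral>p. dirichlet_weight \<beta> p * h p \<partial>?M) - h (dirichlet_mean \<beta>) * dirichlet_const \<beta>\<bar>
      \<le> \<tau> * dirichlet_const \<beta>"
    using dirichlet_expectation_concentrates[OF h_meas h_uc M \<tau>(1)] by blast
  obtain \<delta> where "0 < \<delta>" and \<delta>: "\<And>x y. x \<in> ?I \<Longrightarrow> y \<in> ?I \<Longrightarrow> dist x y < \<delta> \<Longrightarrow> dist (h x) (h y) < \<tau>"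
    using h_uc \<tau>(1) unfolding uniformly_continuous_on_def by metis
  show ?thesis
  \<comment> \<open>The entry \<open>2 / \<delta>\<close> brings the two means, at distance at most
    \<open>2 / (s + 1)\<close>, within \<delta> of each other.\<close>
  proof (intro exI[of _ "max S (2 / \<delta>)"] allI impI)
    fix \<beta> :: "real ^ 'k" and k
    assume "\<forall>i. 0 < \<beta> $ i" and "max S (2 / \<delta>) \<le> (\<Sum>i\<in>UNIV. \<beta> $ i)"
    then have pos: "0 < \<beta> $ i" and S1: "S \<le> (\<Sum>i\<in>UNIV. \<beta> $ i)" and S2: "2 / \<delta> \<le> (\<Sum>i\<in>UNIV. \<beta> $ i)" for i by auto
    let ?s = "\<Sum>i\<in>UNIV. \<beta> $ i"
    let ?\<beta>' = "\<beta> + axis k 1"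
    let ?m = "dirichlet_mean \<beta>" and ?m' = "dirichlet_mean ?\<beta>'"
    let ?B = "dirichlet_const \<beta>" and ?B' = "dirichlet_const ?\<beta>'"
    have s: "0 < ?s" using pos by (intro sum_pos) auto
    have pos': "0 < ?\<beta>' $ j" for j using pos by (auto simp: axis_def add_pos_nonneg)
    have sum': "(\<Sum>j\<in>UNIV. ?\<beta>' $ j) = ?s + 1" by (simp add: sum.distrib axis_def)
    note B = dirichlet_const_pos[OF pos] and m = dirichlet_mean_interior[OF pos]
      and m' = dirichlet_mean_interior[OF pos']
    have mk: "0 < ?m $ k" using m by (auto simp: rel_interior_prob_simplex)
    have B': "?B' = ?m $ k * ?B"
      using dirichlet_const_add_axis[OF pos, of k] by (simp add: dirichlet_mean_def)
    define J where "J = (\<integral>p. dirichlet_weight \<beta> p * h p \<partial>?M) / ?B"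
    define J' where "J' = (\<integral>p. dirichlet_weight ?\<beta>' p * h p \<partial>?M) / ?B'"
    have scale: "\<bar>x / b - y\<bar> \<le> \<tau>" if "\<bar>x - y * b\<bar> \<le> \<tau> * b" "0 < b" for x y b :: real
    proof -
      have "x / b - y = (x - y * b) / b" using that by (simp add: field_simps)
      then show ?thesis using that by (simp add: divide_le_eq)
    qed
    have "\<bar>J - h ?m\<bar> \<le> \<tau>" unfolding J_def by (rule scale[OF S[OF pos S1] B])
    moreover have "\<bar>J' - h ?m'\<bar> \<le> \<tau>"
      unfolding J'_def by (rule scale[OF S[OF pos'] dirichlet_const_pos[OF pos']]) (use sum' S1 in auto)
    moreover have "dist ?m' ?m < \<delta>"
    proof -
      have "dist ?m' ?m \<le> 2 / (?s + 1)"
        using dirichlet_mean_add_axis[OF pos, of k] by (simp add: dist_norm)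
      also have "\<dots> < \<delta>" using S2 \<open>0 < \<delta>\<close> s by (simp add: field_simps add_pos_pos less_le_trans)
      finally show ?thesis .
    qed
    then have "\<bar>h ?m' - h ?m\<bar> \<le> \<tau>" using \<delta>[OF m' m] by (simp add: dist_norm)
    ultimately have J: "\<bar>J' - J\<bar> \<le> 3 * \<tau>" "c / 2 \<le> J" using c(2)[OF m] \<tau>(2) by linarith+
    have "(\<integral>p. p $ k * (dirichlet_weight \<beta> p * h p) \<partial>?M) = (\<integral>p. dirichlet_weight ?\<beta>' p * h p \<partial>?M)"
      by (rule Bochner_Integration.integral_cong) (simp_all add: dirichlet_weight_add_axis)
    also have "\<dots> = J' * (?m $ k * ?B)" using B mk by (simp add: J'_def B')
    finally have num: "(\<integral>p. p $ k * (dirichlet_weight \<beta> p * h p) \<partial>?M) = J' * (?m $ k * ?B)" .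
    have den: "(\<integral>p. dirichlet_weight \<beta> p * h p \<partial>?M) = J * ?B" using B by (simp add: J_def)
    have "0 < J" using J c(1) by linarith
    have "J' * (?m $ k * ?B) / (J * ?B) - ?m $ k = ?m $ k * ((J' - J) / J)"
      using B \<open>0 < J\<close> by (simp add: field_simps)
    then have "\<bar>J' * (?m $ k * ?B) / (J * ?B) - ?m $ k\<bar> = ?m $ k * (\<bar>J' - J\<bar> / J)"
      using mk \<open>0 < J\<close> by (simp add: abs_mult)
    also have "\<dots> \<le> ?m $ k * \<eta>"
    proof (rule mult_left_mono)
      have "\<bar>J' - J\<bar> \<le> \<eta> * (c / 2)" using J(1) \<tau>(3) by linarith
      also have "\<dots> \<le> \<eta> * J" using J(2) \<open>0 < \<eta>\<close> by (intro mult_left_mono) auto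
      finally show "\<bar>J' - J\<bar> / J \<le> \<eta>" using \<open>0 < J\<close> by (simp add: divide_le_eq)
    qed (use mk in simp)
    finally show "\<bar>(\<integral>p. p $ k * (dirichlet_weight \<beta> p * h p) \<partial>?M) /
      (\<integral>p. dirichlet_weight \<beta> p * h p \<partial>?M) - ?m $ k\<bar> \<le> \<eta> * ?m $ k"
      unfolding num den by (simp add: mult.commute)
  qed
qed

section \<open>Posterior means under Condition P\<close>

text \<open>Conjugacy: the likelihood times the Dirichlet weight of \<alpha> is the weight of
  \<alpha> plus the counts, so the posterior is again a Dirichlet law tilted by the same
  \<open>h\<close>. The bound of \<open>tilted_dirichlet_mean\<close> thus applies uniformly in the
  data.\<close>

lemma posterior_mean_close:
  fixes f :: "real ^ 'k::finite \<Rightarrow> real"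
  assumes "simplex_density f" "condition_P_at \<alpha> f" "\<And>i. 0 < \<alpha> $ i" "0 < \<eta>"
  shows "\<exists>S. \<forall>c xs k. S \<le> (\<Sum>i\<in>UNIV. real (count_list xs (c, i))) \<longrightarrow>
    (let m = (\<alpha> $ k + count_list xs (c, k)) /
        ((\<Sum>i\<in>UNIV. \<alpha> $ i) + (\<Sum>i\<in>UNIV. real (count_list xs (c, i))))
     in \<bar>(\<integral>p. p $ k * posterior_density c f xs p \<partial>simplex_lebesgue) - m\<bar> \<le> \<eta> * m)"
proof -
  let ?I = "rel_interior (prob_simplex :: (real ^ 'k) set)"
  let ?M = "simplex_lebesgue :: (real ^ 'k) measure"
  define h where "h p = f p / dirichlet_weight \<alpha> p" for p
  have f_meas: "f \<in> borel_measurable ?M" using assms(1) by (simp add: simplex_density_def)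
  then have h_meas: "h \<in> borel_measurable ?M"
    unfolding h_def using borel_measurable_simplex_lebesgue[OF dirichlet_weight_borel] by measurable
  have "h = (\<lambda>p. f p / (\<Prod>i\<in>UNIV. p $ i powr (\<alpha> $ i - 1)))"
    by (simp add: h_def dirichlet_weight_def fun_eq_iff)
  then have "uniformly_continuous_on ?I h \<and> (\<exists>b>0. \<forall>p\<in>?I. b \<le> h p)"
    using assms(2) by (simp add: condition_P_at_def Let_def)
  then obtain b where h_uc: "uniformly_continuous_on ?I h" and b: "0 < b" "\<And>p. p \<in> ?I \<Longrightarrow> b \<le> h p"
    by blast
  obtain S where S: "\<And>\<beta> k. (\<And>i. 0 < \<beta> $ i) \<Longrightarrow> S \<le> (\<Sum>i\<in>UNIV. \<beta> $ i) \<Longrightarrow>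
    \<bar>(\<integral>p. p $ k * (dirichlet_weight \<beta> p * h p) \<partial>?M) /
      (\<integral>p. dirichlet_weight \<beta> p * h p \<partial>?M) - dirichlet_mean \<beta> $ k\<bar> \<le> \<eta> * dirichlet_mean \<beta> $ k"
    using tilted_dirichlet_mean[OF h_meas h_uc b \<open>0 < \<eta>\<close>] by blast
  show ?thesis
  proof (intro exI[of _ S] allI impI)
    fix c :: color and xs :: "(color \<times> 'k) list" and k
    let ?N = "\<Sum>i\<in>UNIV. real (count_list xs (c, i))"
    assume N: "S \<le> ?N"
    define m where "m = (\<alpha> $ k + count_list xs (c, k)) / ((\<Sum>i\<in>UNIV. \<alpha> $ i) + ?N)"
    define \<beta> :: "real ^ 'k" where "\<beta> = (\<chi> i. \<alpha> $ i + count_list xs (c, i))"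
    have pos: "0 < \<beta> $ i" for i using assms(3)[of i] by (simp add: \<beta>_def add_pos_nonneg)
    have sum\<beta>: "(\<Sum>i\<in>UNIV. \<beta> $ i) = (\<Sum>i\<in>UNIV. \<alpha> $ i) + ?N" by (simp add: \<beta>_def sum.distrib)
    have m_eq: "m = dirichlet_mean \<beta> $ k" by (simp add: m_def dirichlet_mean_def sum\<beta>) (simp add: \<beta>_def)
    have "0 \<le> (\<Sum>i\<in>UNIV. \<alpha> $ i)" using assms(3) by (intro sum_nonneg) (auto intro: less_imp_le)
    then have S\<beta>: "S \<le> (\<Sum>i\<in>UNIV. \<beta> $ i)" using N unfolding sum\<beta> by linarith
    \<comment> \<open>Dividing by the weight of \<alpha> is reversible only where that weight is
      nonzero, so the factorization is stated on the interior and enters the integrals almost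
      everywhere.\<close>
    have L: "likelihood c xs p * f p = dirichlet_weight \<beta> p * h p" if "p \<in> ?I" for p
    proof -
      have pp: "0 < p $ i" for i using that by (simp add: rel_interior_prob_simplex)
      have "0 < dirichlet_weight \<alpha> p" unfolding dirichlet_weight_def
        by (intro prod_pos) (simp add: pp[THEN less_imp_neq, THEN not_sym])
      then have "f p = dirichlet_weight \<alpha> p * h p" by (simp add: h_def)
      moreover have "likelihood c xs p * dirichlet_weight \<alpha> p = dirichlet_weight \<beta> p"
        unfolding likelihood_def dirichlet_weight_def prod.distrib[symmetric]
      proof (rule prod.cong[OF refl])
        fix i
        have "p $ i ^ count_list xs (c, i) = p $ i powr count_list xs (c, i)"
          using pp by (simp add: powr_realpow)
        then show "p $ i ^ count_list xs (c, i) * p $ i powr (\<alpha> $ i - 1) = p $ i powr (\<beta> $ i - 1)"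
          by (simp add: \<beta>_def powr_add[symmetric] algebra_simps)
      qed
      ultimately show ?thesis by (metis mult.assoc)
    qed
    have l_meas: "likelihood c xs \<in> borel_measurable ?M"
      unfolding likelihood_def by (intro borel_measurable_simplex_lebesgue) measurable
    note w_meas = borel_measurable_simplex_lebesgue[OF dirichlet_weight_borel[of \<beta>]]
    note k_meas = borel_measurable_simplex_lebesgue[OF measurable_vec_nth[of k]]
    have den: "(\<integral>p. likelihood c xs p * f p \<partial>?M) = (\<integral>p. dirichlet_weight \<beta> p * h p \<partial>?M)"
    proof (rule integral_cong_AE)
      show "AE p in ?M. likelihood c xs p * f p = dirichlet_weight \<beta> p * h p"
        using AE_simplex_interior by eventually_elim (rule L)
    qed (use l_meas f_meas w_meas h_meas in measurable)
    have num: "(\<integral>p. p $ k * (likelihood c xs p * f p) \<partial>?M) = (\<integral>p. p $ k * (dirichlet_weight \<beta> p * h p) \<partial>?M)"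
    proof (rule integral_cong_AE)
      show "AE p in ?M. p $ k * (likelihood c xs p * f p) = p $ k * (dirichlet_weight \<beta> p * h p)"
        using AE_simplex_interior by eventually_elim (simp add: L)
    qed (use l_meas f_meas w_meas h_meas k_meas in measurable)
    have "(\<integral>p. p $ k * posterior_density c f xs p \<partial>?M) =
        (\<integral>p. p $ k * (likelihood c xs p * f p) / (\<integral>s. likelihood c xs s * f s \<partial>?M) \<partial>?M)"
      by (simp add: posterior_density_def)
    also have "\<dots> = (\<integral>p. p $ k * (dirichlet_weight \<beta> p * h p) \<partial>?M) / (\<integral>p. dirichlet_weight \<beta> p * h p \<partial>?M)"
      unfolding den integral_divide_zero num ..
    finally have "\<bar>(\<integral>p. p $ k * posterior_density c f xs p \<partial>?M) - m\<bar> \<le> \<eta> * m"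
      unfolding m_eq using S[OF pos S\<beta>, of k] by simp
    then show "let m = (\<alpha> $ k + count_list xs (c, k)) / ((\<Sum>i\<in>UNIV. \<alpha> $ i) + ?N)
      in \<bar>(\<integral>p. p $ k * posterior_density c f xs p \<partial>?M) - m\<bar> \<le> \<eta> * m"
      by (simp add: m_def Let_def)
  qed
qed

section \<open>Deviations of the toss counts\<close>

lemma prob_space_dice_process: "prob_space (dice_process \<mu> p q)"
  unfolding dice_process_def by (intro prob_space_PiM measure_pmf.prob_space_axioms)

lemma space_dice_process [simp]: "space (dice_process \<mu> p q) = UNIV"
  by (simp add: dice_process_def space_PiM)

lemma measurable_dice_process_component:
  "(\<lambda>\<omega>. \<omega> t) \<in> measurable (dice_process \<mu> p q) (measure_pmf (toss_pmf \<mu> p q))"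
  unfolding dice_process_def by (rule measurable_component_singleton) simp

lemma distr_dice_process_component:
  "distr (dice_process \<mu> p q) (measure_pmf (toss_pmf \<mu> p q)) (\<lambda>\<omega>. \<omega> t) = measure_pmf (toss_pmf \<mu> p q)"
  unfolding dice_process_def
  by (rule distr_PiM_component[of UNIV "\<lambda>_. measure_pmf (toss_pmf \<mu> p q)"])
     (auto simp: measure_pmf.prob_space_axioms)

lemma indep_vars_dice_process:
  "prob_space.indep_vars (dice_process \<mu> p q) (\<lambda>_. measure_pmf (toss_pmf \<mu> p q)) (\<lambda>t \<omega>. \<omega> t) UNIV"
proof -
  interpret prob_space "dice_process \<mu> p q" by (rule prob_space_dice_process)
  show ?thesis
  proof (subst indep_vars_iff_distr_eq_PiM)
    show "distr (dice_process \<mu> p q) (\<Pi>\<^sub>M i\<in>UNIV. measure_pmf (toss_pmf \<mu> p q)) (\<lambda>x. \<lambda>i\<in>UNIV. x i) =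
      (\<Pi>\<^sub>M i\<in>UNIV. distr (dice_process \<mu> p q) (measure_pmf (toss_pmf \<mu> p q)) (\<lambda>\<omega>. \<omega> i))"
      by (simp add: distr_dice_process_component restrict_UNIV)
         (simp add: dice_process_def distr_id[unfolded id_def])
  qed (use measurable_dice_process_component[of _ \<mu> p q] in auto)
qed

lemma observations_measurable:
  fixes p q :: "real ^ 'k::finite"
  shows "observations n \<in> measurable (dice_process \<mu> p q) (count_space UNIV)"
proof (induction n)
  case (Suc n)
  have fin: "countable (UNIV :: (color \<times> 'k) set)"
  proof -
    have "(UNIV :: color set) = {Blue, Red}" by (auto intro: color.exhaust)
    then have "finite (UNIV :: color set)" by (metis finite.emptyI finite.insertI)
    then show ?thesis by (metis UNIV_Times_UNIV countable_finite finite finite_SigmaI)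
  qed
  have comp: "(\<lambda>\<omega>. \<omega> n) \<in> measurable (dice_process \<mu> p q) (count_space UNIV)"
    using measurable_dice_process_component[of n \<mu> p q] by simp
  \<comment> \<open>The last outcome takes countably many values, so it suffices to append each
    fixed outcome to a measurable list.\<close>
  have "(\<lambda>\<omega>. observations n \<omega> @ [\<omega> n]) \<in> measurable (dice_process \<mu> p q) (count_space UNIV)"
    by (rule measurable_compose_countable'[OF _ comp fin])
       (use Suc in \<open>auto intro: measurable_compose\<close>)
  then show ?case by (simp add: observations_def)
qed (simp add: observations_def)

lemma observations_pred_sets:
  "{\<omega>. Q (observations n \<omega>)} \<in> sets (dice_process \<mu> p q)"
  using measurable_sets[OF observations_measurable, of "{xs. Q xs}" n \<mu> p q]
  by (simp add: vimage_def)

text \<open>The deviation is measured against an upper bound \<open>m'\<close> of the success probability \<open>m\<close> because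
  the red die may show a side far more rarely than the blue one, too rarely for its count to be
  accurate relative to its own mean.\<close>

lemma dice_count_deviation:
  fixes \<mu> :: real and p q :: "real ^ 'k::finite" and S :: "(color \<times> 'k) set"
  defines "m \<equiv> measure_pmf.prob (toss_pmf \<mu> p q) S"
  assumes "m \<le> m'" "0 < \<delta>" "0 < L" "L \<le> real n * m'"
  shows "measure (dice_process \<mu> p q)
     {\<omega>. \<delta> * (n * m') \<le> \<bar>real (length (filter (\<lambda>x. x \<in> S) (observations n \<omega>))) - n * m\<bar>} \<le> 1 / (\<delta>\<^sup>2 * L)"
proof -
  let ?D = "dice_process \<mu> p q" and ?T = "toss_pmf \<mu> p q"
  interpret prob_space ?D by (rule prob_space_dice_process)
  define g :: "color \<times> 'k \<Rightarrow> real" where "g x = indicator S x - m" for x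
  have comp: "(\<lambda>\<omega>. \<omega> t) \<in> measurable ?D (count_space UNIV)" for t
    using measurable_dice_process_component[of t \<mu> p q] by simp
  have gmeas [measurable]: "(\<lambda>\<omega>. g (\<omega> t)) \<in> borel_measurable ?D" for t
    by (rule measurable_compose[OF comp]) simp
  have m01: "0 \<le> m" "m \<le> 1" unfolding m_def by auto
  have gbound: "\<bar>g x\<bar> \<le> 1" for x
    using m01 by (auto simp: g_def indicator_def)
  have gint: "integrable ?D (\<lambda>\<omega>. g (\<omega> t))" for t
    by (rule integrable_const_bound[of _ 1]) (use gbound in auto)
  have gint2: "integrable ?D (\<lambda>\<omega>. g (\<omega> t) * g (\<omega> s))" for t s
    by (rule integrable_const_bound[of _ 1]) (use gbound in \<open>auto simp: abs_mult mult_le_one\<close>)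
  have transfer: "(\<integral>\<omega>. h (\<omega> t) \<partial>?D) = (\<integral>x. h x \<partial>?T)" for h :: "_ \<Rightarrow> real" and t
  proof -
    have "(\<integral>x. h x \<partial>?T) = (\<integral>x. h x \<partial>distr ?D ?T (\<lambda>\<omega>. \<omega> t))"
      by (simp add: distr_dice_process_component)
    also have "\<dots> = (\<integral>\<omega>. h (\<omega> t) \<partial>?D)"
      by (rule integral_distr[OF measurable_dice_process_component]) simp
    finally show ?thesis by simp
  qed
  have ind_int: "integrable ?T (indicator S :: _ \<Rightarrow> real)"
    by (rule measure_pmf.integrable_const_bound[of _ 1]) auto
  have mean0: "(\<integral>\<omega>. g (\<omega> t) \<partial>?D) = 0" for t
    unfolding transfer[of g] unfolding g_def using ind_int by (simp add: m_def)
  have gsq: "(\<integral>\<omega>. g (\<omega> t) * g (\<omega> t) \<partial>?D) \<le> m" for t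
  proof -
    \<comment> \<open>Since an indicator equals its own square, the second moment is affine in the
      indicator; its expectation \<open>m - m * m\<close> is the Bernoulli variance.\<close>
    have eq: "g x * g x = (1 - 2 * m) * indicator S x + m * m" for x
      by (auto simp: g_def indicator_def algebra_simps)
    have "(\<integral>\<omega>. g (\<omega> t) * g (\<omega> t) \<partial>?D) = (\<integral>x. (1 - 2 * m) * indicator S x + m * m \<partial>?T)"
      unfolding transfer[of "\<lambda>x. g x * g x"] by (simp only: eq)
    also have "\<dots> = (1 - 2 * m) * m + m * m"
      using ind_int by (simp add: m_def)
    also have "\<dots> \<le> m" by (simp add: algebra_simps)
    finally show ?thesis .
  qed
  \<comment> \<open>Independence of distinct tosses kills the cross terms, so the variance of the
    count is at most \<open>n * m\<close>.\<close>
  have off: "(\<integral>\<omega>. g (\<omega> s) * g (\<omega> t) \<partial>?D) = 0" if "s \<noteq> t" for s t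
  proof -
    have iv: "indep_vars (\<lambda>_. borel) (\<lambda>t \<omega>. g (\<omega> t)) {s, t}"
      using indep_vars_compose2[OF indep_vars_subset[OF indep_vars_dice_process, of "{s,t}"], of "\<lambda>_. g" "\<lambda>_. borel"]
      by simp
    have "(\<integral>\<omega>. (\<Prod>i\<in>{s,t}. g (\<omega> i)) \<partial>?D) = (\<Prod>i\<in>{s,t}. \<integral>\<omega>. g (\<omega> i) \<partial>?D)"
      by (rule indep_vars_lebesgue_integral) (use iv gint in auto)
    then show ?thesis using that by (simp add: mean0)
  qed
  define X where "X \<omega> = (\<Sum>t<n. g (\<omega> t))" for \<omega>
  have X_count: "X \<omega> = real (length (filter (\<lambda>x. x \<in> S) (observations n \<omega>))) - n * m" for \<omega>
    unfolding X_def
  proof (induction n)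
    case (Suc n)
    then show ?case by (simp add: observations_def g_def algebra_simps)
  qed (simp add: observations_def)
  have X_meas: "X \<in> borel_measurable ?D" unfolding X_def by simp
  have X2: "X \<omega> ^ 2 = (\<Sum>s<n. \<Sum>t<n. g (\<omega> s) * g (\<omega> t))" for \<omega>
    by (simp add: X_def power2_eq_square sum_product)
  have X2_int: "integrable ?D (\<lambda>\<omega>. X \<omega> ^ 2)"
    unfolding X2 using gint2 by auto
  have EX: "expectation X = 0"
    unfolding X_def using gint mean0 by (subst Bochner_Integration.integral_sum) auto
  have "expectation (\<lambda>\<omega>. X \<omega> ^ 2) = (\<Sum>s<n. \<Sum>t<n. \<integral>\<omega>. g (\<omega> s) * g (\<omega> t) \<partial>?D)"
    unfolding X2 using gint2 by (simp add: Bochner_Integration.integral_sum)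
  also have "\<dots> = (\<Sum>s<n. \<integral>\<omega>. g (\<omega> s) * g (\<omega> s) \<partial>?D)"
  proof (rule sum.cong[OF refl])
    fix s assume "s \<in> {..<n}"
    then have "(\<Sum>t<n. \<integral>\<omega>. g (\<omega> s) * g (\<omega> t) \<partial>?D) = (\<Sum>t\<in>{s}. \<integral>\<omega>. g (\<omega> s) * g (\<omega> t) \<partial>?D)"
      by (intro sum.mono_neutral_right) (auto intro: off)
    then show "(\<Sum>t<n. \<integral>\<omega>. g (\<omega> s) * g (\<omega> t) \<partial>?D) = (\<integral>\<omega>. g (\<omega> s) * g (\<omega> s) \<partial>?D)" by simp
  qed
  also have "\<dots> \<le> (\<Sum>s<n. m)" by (intro sum_mono gsq)
  finally have var: "variance X \<le> n * m" by (simp add: EX)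
  let ?a = "\<delta> * (n * m')"
  have a: "0 < ?a" using assms by simp
  have "prob {\<omega>\<in>space ?D. ?a \<le> \<bar>X \<omega> - expectation X\<bar>} \<le> variance X / ?a\<^sup>2"
    using X_meas X2_int a by (rule Chebyshev_inequality)
  also have "\<dots> \<le> (n * m') / ?a\<^sup>2"
    \<comment> \<open>Bounding the variance by \<open>n * m'\<close> lets one factor cancel against
      the squared deviation, leaving a bound that does not involve the true probability
      \<open>m\<close>.\<close>
    using var assms mult_left_mono[OF \<open>m \<le> m'\<close>, of "real n"] by (intro divide_right_mono) auto
  also have "\<dots> = 1 / (\<delta>\<^sup>2 * (n * m'))"
    using a by (simp add: power2_eq_square)
  also have "\<dots> \<le> 1 / (\<delta>\<^sup>2 * L)"
    using assms by (intro frac_le mult_left_mono mult_pos_pos) auto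
  finally show ?thesis by (simp add: EX X_count)
qed

text \<open>Connects the deviation bound, which counts tosses in a set of outcomes, with the color
  totals appearing in \<open>posterior_mean_close\<close>.\<close>

lemma length_filter_color:
  "length (filter (\<lambda>x. x \<in> range (Pair c)) xs) = (\<Sum>i\<in>UNIV. count_list xs (c, i :: 'k::finite))"
proof (induction xs)
  case (Cons x xs)
  obtain d j where "x = (d, j)" by (cases x)
  have "(\<Sum>i\<in>UNIV. count_list (x # xs) (c, i)) =
      (\<Sum>i\<in>UNIV. count_list xs (c, i)) + (\<Sum>i\<in>UNIV. if i = j then (if d = c then 1 else 0) else 0)"
    unfolding sum.distrib[symmetric] by (rule sum.cong) (auto simp: \<open>x = (d, j)\<close>)
  then show ?case using Cons \<open>x = (d, j)\<close> by (auto simp del: count_list.simps(2))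
qed simp

lemma length_filter_singleton: "length (filter (\<lambda>x. x \<in> {a}) xs) = count_list xs a"
  by (induction xs) auto

lemma prob_toss_color:
  fixes p q :: "real ^ 'k::finite"
  assumes "p \<in> prob_simplex" "q \<in> prob_simplex" "0 \<le> \<mu>" "\<mu> \<le> 1"
  shows "measure_pmf.prob (toss_pmf \<mu> p q) (range (Pair Blue)) = \<mu>"
    and "measure_pmf.prob (toss_pmf \<mu> p q) (range (Pair Red)) = 1 - \<mu>"
proof -
  have "measure_pmf.prob (toss_pmf \<mu> p q) (range (Pair c)) = (\<Sum>i\<in>UNIV. pmf (toss_pmf \<mu> p q) (c, i))" for c
    by (simp add: measure_measure_pmf_finite sum.reindex inj_on_def)
  then show "measure_pmf.prob (toss_pmf \<mu> p q) (range (Pair Blue)) = \<mu>"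
    "measure_pmf.prob (toss_pmf \<mu> p q) (range (Pair Red)) = 1 - \<mu>"
    using assms by (simp_all add: pmf_toss_pmf sum_distrib_left[symmetric] prob_simplex_nonneg_iff)
qed

section \<open>Comparison of the two posterior means when all counts are typical\<close>

text \<open>Clearing denominators leaves \<open>(1 - 10 * \<delta>) * (1 + \<delta>) * (1 + 2 *
  \<delta>)\<^sup>2 < (1 - \<delta>) ^ 3\<close>. To first order the errors cost
  \<open>8 * \<delta>\<close>, so the factor 10 leaves slack; \<open>1 - 5 * \<delta>\<close>
  separates the two sides.\<close>

lemma ratio_margin:
  fixes \<delta> :: real
  assumes "0 < \<delta>" "\<delta> < 1 / 10"
  shows "(1 - 10 * \<delta>) * ((1 + \<delta>) * ((1 + 2 * \<delta>) / (1 - \<delta>))) < (1 - \<delta>) * ((1 - \<delta>) / (1 + 2 * \<delta>))"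
proof -
  have "(1 - 10 * \<delta>) * ((1 + \<delta>) * (1 + 2 * \<delta>)\<^sup>2) \<le> 1 - 5 * \<delta>"
  proof -
    have "(1 - 10 * \<delta>) * ((1 + \<delta>) * (1 + 2 * \<delta>)\<^sup>2) = 1 - 5 * \<delta> - (42 * \<delta>\<^sup>2 + 76 * \<delta> ^ 3 + 40 * \<delta> ^ 4)"
      by (simp add: algebra_simps power2_eq_square power3_eq_cube power4_eq_xxxx)
    moreover have "0 \<le> 42 * \<delta>\<^sup>2 + 76 * \<delta> ^ 3 + 40 * \<delta> ^ 4" using assms by simp
    ultimately show ?thesis by linarith
  qed
  also have "\<dots> < (1 - \<delta>) ^ 3"
  proof -
    have "(1 - \<delta>) ^ 3 = 1 - 3 * \<delta> + \<delta>\<^sup>2 * (3 - \<delta>)"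
      by (simp add: algebra_simps power2_eq_square power3_eq_cube)
    moreover have "0 \<le> \<delta>\<^sup>2 * (3 - \<delta>)" using assms by simp
    ultimately show ?thesis using assms by linarith
  qed
  finally show ?thesis
    using assms by (simp add: field_simps power2_eq_square power3_eq_cube)
qed

text \<open>Here \<open>nB\<close> and \<open>nR\<close> are the expected numbers of tosses of each color, \<open>cB\<close> and \<open>cR\<close> the actual ones,
  \<open>y\<close> and \<open>z\<close> the counts of the side in question, \<open>a\<close>, \<open>a'\<close>, \<open>A\<close>, \<open>A'\<close> the prior pseudo-counts, and
  \<open>x\<close> the blue probability of the side.\<close>

lemma odds_margin:
  fixes \<delta> :: real
  assumes \<delta>: "0 < \<delta>" "\<delta> < 1 / 10" and pos: "0 < nB" "0 < nR" "0 < x"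
    and "0 \<le> a" "a \<le> A" "A \<le> \<delta> * nB" "0 < a'" "a' \<le> A'" "a' \<le> \<delta> * (nR * x)"
    and y: "\<bar>y - nB * x\<bar> < \<delta> * (nB * x)" and cB: "\<bar>cB - nB\<bar> < \<delta> * nB"
    and z: "z < (1 + \<delta>) * (nR * x)" "0 \<le> z" and cR: "\<bar>cR - nR\<bar> < \<delta> * nR"
    and EB: "\<bar>EB - (a + y) / (A + cB)\<bar> \<le> \<delta> * ((a + y) / (A + cB))"
    and ER: "\<bar>ER - (a' + z) / (A' + cR)\<bar> \<le> \<delta> * ((a' + z) / (A' + cR))"
  shows "0 < ER" "(1 - 10 * \<delta>) * ER < EB"
proof -
  have cR': "(1 - \<delta>) * nR < cR" and cB': "cB < (1 + \<delta>) * nB" "(1 - \<delta>) * nB < cB" and y': "(1 - \<delta>) * (nB * x) < y"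
    using cR cB y by (simp_all add: algebra_simps abs_less_iff)
  have pR: "0 < (1 - \<delta>) * nR" and pB: "0 < (1 - \<delta>) * nB" using \<delta> pos by auto
  let ?mB = "(a + y) / (A + cB)" and ?mR = "(a' + z) / (A' + cR)"
  have "0 < A' + cR" using cR' pR assms by linarith
  then have mR_pos: "0 < ?mR" using assms by simp
  \<comment> \<open>The prior count \<open>a'\<close> costs the second \<delta> in the numerator;
    the denominator only shrinks when \<open>A'\<close> is dropped.\<close>
  have "?mR \<le> ((1 + 2 * \<delta>) * (nR * x)) / ((1 - \<delta>) * nR)"
    using z pR cR' assms by (intro frac_le) (auto simp: algebra_simps)
  also have "\<dots> = (1 + 2 * \<delta>) / (1 - \<delta>) * x" using pos by simp
  finally have mR: "?mR \<le> (1 + 2 * \<delta>) / (1 - \<delta>) * x" .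
  have "0 < (1 - \<delta>) * (nB * x)" using \<delta> pos by simp
  then have "0 < y" "0 < cB" using y' cB' pB by linarith+
  \<comment> \<open>For a lower bound the roles are reversed: \<open>a\<close> is dropped from the
    numerator, and \<open>A\<close> costs the second \<delta> in the denominator.\<close>
  have "(1 - \<delta>) / (1 + 2 * \<delta>) * x = ((1 - \<delta>) * (nB * x)) / ((1 + 2 * \<delta>) * nB)"
    using pos by simp
  also have "\<dots> \<le> ?mB"
    using y' \<open>0 < y\<close> \<open>0 < cB\<close> cB' assms by (intro frac_le) (auto simp: algebra_simps)
  finally have mB: "(1 - \<delta>) / (1 + 2 * \<delta>) * x \<le> ?mB" .
  have "(1 - \<delta>) * ?mR \<le> ER" "ER \<le> (1 + \<delta>) * ?mR" "(1 - \<delta>) * ?mB \<le> EB"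
    using ER EB by (simp_all only: abs_le_iff left_diff_distrib distrib_right mult_1) linarith+
  note E = this
  have "0 < (1 - \<delta>) * ?mR" using \<delta> mR_pos by (intro mult_pos_pos) auto
  with E show "0 < ER" by linarith
  have "(1 - 10 * \<delta>) * ER \<le> (1 - 10 * \<delta>) * ((1 + \<delta>) * ((1 + 2 * \<delta>) / (1 - \<delta>) * x))"
    using E(2) mR \<delta> by (intro mult_left_mono order_trans[OF E(2)]) auto
  also have "\<dots> = ((1 - 10 * \<delta>) * ((1 + \<delta>) * ((1 + 2 * \<delta>) / (1 - \<delta>)))) * x" by simp
  also have "\<dots> < ((1 - \<delta>) * ((1 - \<delta>) / (1 + 2 * \<delta>))) * x"
    by (rule mult_strict_right_mono[OF ratio_margin[OF \<delta>] pos(3)])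
  also have "\<dots> = (1 - \<delta>) * ((1 - \<delta>) / (1 + 2 * \<delta>) * x)" by simp
  also have "\<dots> \<le> (1 - \<delta>) * ?mB" using mB \<delta> by (intro mult_left_mono) auto
  also have "\<dots> \<le> EB" by (rule E(3))
  finally show "(1 - 10 * \<delta>) * ER < EB" .
qed

section \<open>Choice of the threshold and union bound over four deviation events\<close>

theorem corollary2:
  fixes \<pi> \<rho> :: "real ^ 'k::finite \<Rightarrow> real"
    and \<mu>B \<mu>R \<epsilon> :: real
    and kbar :: 'k
  assumes "CARD('k) \<ge> 2"
    and "0 < \<mu>B" "\<mu>B < 1" "\<mu>R = 1 - \<mu>B"
    and "simplex_density \<pi>" "simplex_density \<rho>"
    and "condition_P \<pi>" "condition_P \<rho>"
    and "0 < \<epsilon>" "\<epsilon> < 1"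
  shows "\<exists>N::nat. N \<ge> 1 \<and>
    (\<forall>p\<in>prob_simplex. \<forall>q\<in>prob_simplex. \<forall>n::nat.
       n \<ge> 1 \<longrightarrow> p $ kbar \<ge> q $ kbar \<longrightarrow> real n * p $ kbar \<ge> real N \<longrightarrow>
       measure (dice_process \<mu>B p q)
         {\<omega> \<in> space (dice_process \<mu>B p q).
            posterior_odds \<mu>B \<mu>R \<pi> \<rho> kbar (observations n \<omega>) > (1 - \<epsilon>) * (\<mu>B / \<mu>R)}
       \<ge> 1 - \<epsilon>)"
proof -
  obtain \<alpha> \<alpha>' where \<alpha>: "\<And>i. 0 < \<alpha> $ i" "condition_P_at \<alpha> \<pi>" and \<alpha>': "\<And>i. 0 < \<alpha>' $ i" "condition_P_at \<alpha>' \<rho>"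
    using assms(7,8) unfolding condition_P_def by auto
  \<comment> \<open>Matches the loss \<open>1 - 10 * \<delta>\<close> of \<open>odds_margin\<close>
    with \<open>1 - \<epsilon>\<close>.\<close>
  define \<delta> where "\<delta> = \<epsilon> / 10"
  have \<delta>: "0 < \<delta>" "\<delta> < 1 / 10" using assms(9,10) by (auto simp: \<delta>_def)
  obtain SB where SB: "\<And>c xs k. SB \<le> (\<Sum>i\<in>UNIV. real (count_list xs (c, i))) \<Longrightarrow>
    (let m = (\<alpha> $ k + count_list xs (c, k)) / ((\<Sum>i\<in>UNIV. \<alpha> $ i) + (\<Sum>i\<in>UNIV. real (count_list xs (c, i))))
     in \<bar>(\<integral>p. p $ k * posterior_density c \<pi> xs p \<partial>simplex_lebesgue) - m\<bar> \<le> \<delta> * m)"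
    using posterior_mean_close[OF assms(5) \<alpha>(2) \<alpha>(1) \<delta>(1)] by blast
  obtain SR where SR: "\<And>c xs k. SR \<le> (\<Sum>i\<in>UNIV. real (count_list xs (c, i))) \<Longrightarrow>
    (let m = (\<alpha>' $ k + count_list xs (c, k)) / ((\<Sum>i\<in>UNIV. \<alpha>' $ i) + (\<Sum>i\<in>UNIV. real (count_list xs (c, i))))
     in \<bar>(\<integral>p. p $ k * posterior_density c \<rho> xs p \<partial>simplex_lebesgue) - m\<bar> \<le> \<delta> * m)"
    using posterior_mean_close[OF assms(6) \<alpha>'(2) \<alpha>'(1) \<delta>(1)] by blast
  let ?A = "\<Sum>i\<in>UNIV. \<alpha> $ i" and ?A' = "\<Sum>i\<in>UNIV. \<alpha>' $ i"
  have \<alpha>_le: "\<alpha> $ kbar \<le> ?A" and \<alpha>'_le: "\<alpha>' $ kbar \<le> ?A'"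
    using \<alpha>(1) \<alpha>'(1) by (auto intro!: member_le_sum simp: less_imp_le)
  define \<mu> where "\<mu> = min \<mu>B \<mu>R"
  have \<mu>: "0 < \<mu>" "\<mu> \<le> \<mu>B" "\<mu> \<le> \<mu>R" using assms(2-4) by (auto simp: \<mu>_def)
  \<comment> \<open>The entries ensure, in order: each Chebyshev bound is at most
    \<open>\<epsilon> / 4\<close>; the prior totals are at most \<delta> times
    \<open>\<mu> * N\<close>; and color totals within a relative error \<delta> of their means reach
    the thresholds \<open>SB\<close> and \<open>SR\<close>.\<close>
  define R where "R = Max {4 / (\<epsilon> * \<delta>\<^sup>2 * \<mu>), ?A / (\<delta> * \<mu>), ?A' / (\<delta> * \<mu>), SB / ((1 - \<delta>) * \<mu>), SR / ((1 - \<delta>) * \<mu>)}"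
  \<comment> \<open>The successor makes \<open>N\<close> positive, which later forces
    \<open>p $ kbar\<close> and \<open>n\<close> to be positive.\<close>
  define N where "N = Suc (nat \<lceil>R\<rceil>)"
  have "R \<le> N" unfolding N_def by linarith
  then have "4 / (\<epsilon> * \<delta>\<^sup>2 * \<mu>) \<le> N" "?A / (\<delta> * \<mu>) \<le> N" "?A' / (\<delta> * \<mu>) \<le> N"
    "SB / ((1 - \<delta>) * \<mu>) \<le> N" "SR / ((1 - \<delta>) * \<mu>) \<le> N"
    by (simp_all add: R_def)
  then have N: "4 \<le> N * (\<epsilon> * \<delta>\<^sup>2 * \<mu>)" "?A \<le> \<delta> * (\<mu> * N)" "?A' \<le> \<delta> * (\<mu> * N)"
    "SB \<le> (1 - \<delta>) * (\<mu> * N)" "SR \<le> (1 - \<delta>) * (\<mu> * N)"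
    using \<mu>(1) \<delta> assms(9) by (simp_all add: pos_divide_le_eq mult_ac)
  have N1: "1 \<le> N" by (simp add: N_def)
  show ?thesis
  proof (intro exI[of _ N] conjI N1 ballI allI impI)
    fix p q :: "real ^ 'k" and n :: nat
    assume p: "p \<in> prob_simplex" and q: "q \<in> prob_simplex" and "q $ kbar \<le> p $ kbar"
      and nN: "real N \<le> real n * p $ kbar"
    let ?D = "dice_process \<mu>B p q" and ?x = "p $ kbar"
    interpret prob_space ?D by (rule prob_space_dice_process)
    have x: "0 \<le> ?x" "?x \<le> 1" using p by (auto simp: prob_simplex_def)
    have "?x \<noteq> 0" using nN N1 by auto
    with x have "0 < ?x" by simp
    have "real n * ?x \<le> real n" using x by (intro mult_left_le) auto
    then have "real N \<le> real n" using nN by linarith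
    then have "0 < n" using N1 by auto
    \<comment> \<open>The single quantity \<open>\<mu> * N\<close> lies below all four scales
      against which deviations are measured; for the color totals this uses
      \<open>N \<le> n\<close>, as \<open>?x \<le> 1\<close>.\<close>
    have LB: "\<mu> * N \<le> n * (\<mu>B * ?x)" and LR: "\<mu> * N \<le> n * (\<mu>R * ?x)"
      using mult_mono[OF \<mu>(2) nN] mult_mono[OF \<mu>(3) nN] \<mu> by (auto simp: mult_ac)
    have nB: "\<mu> * N \<le> n * \<mu>B" and nR: "\<mu> * N \<le> n * \<mu>R"
      using mult_mono[OF \<mu>(2) \<open>real N \<le> real n\<close>] mult_mono[OF \<mu>(3) \<open>real N \<le> real n\<close>] \<mu> by (auto simp: mult_ac)
    have L: "0 < \<mu> * N" using \<mu> N1 by simp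
    define G where "G S m m' = {\<omega>. \<delta> * (n * m') \<le> \<bar>real (length (filter (\<lambda>x. x \<in> S) (observations n \<omega>))) - n * m\<bar>}"
      for S :: "(color \<times> 'k) set" and m m' :: real
    have G_sets [measurable]: "G S m m' \<in> events" for S m m'
      unfolding G_def by (rule observations_pred_sets)
    have G: "prob (G S m m') \<le> \<epsilon> / 4"
      if "measure_pmf.prob (toss_pmf \<mu>B p q) S = m" "m \<le> m'" "\<mu> * N \<le> n * m'" for S and m m' :: real
    proof -
      have "prob (G S m m') \<le> 1 / (\<delta>\<^sup>2 * (\<mu> * N))"
        using dice_count_deviation[of \<mu>B p q S m' \<delta> "\<mu> * N" n] that \<delta> L by (simp add: G_def)
      also have "\<dots> \<le> \<epsilon> / 4"
      proof -
        have "0 < \<delta>\<^sup>2 * (\<mu> * N)" using \<delta>(1) L by simp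
        moreover have "1 \<le> \<epsilon> / 4 * (\<delta>\<^sup>2 * (\<mu> * N))" using N(1) by (simp add: mult_ac)
        ultimately show ?thesis by (simp only: pos_divide_le_eq)
      qed
      finally show ?thesis .
    qed
    note toss = pmf_toss_pmf[OF p q less_imp_le[OF assms(2)] less_imp_le[OF assms(3)]]
    note color = prob_toss_color[OF p q less_imp_le[OF assms(2)] less_imp_le[OF assms(3)]]
    \<comment> \<open>In \<open>?G2\<close> the red count is centered at its own mean, but its
      deviation is scaled by \<open>\<mu>R * ?x\<close>, because \<open>q $ kbar\<close> may be
      arbitrarily small or 0.\<close>
    let ?G1 = "G {(Blue, kbar)} (\<mu>B * ?x) (\<mu>B * ?x)" and ?G2 = "G {(Red, kbar)} (\<mu>R * q $ kbar) (\<mu>R * ?x)"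
      and ?G3 = "G (range (Pair Blue)) \<mu>B \<mu>B" and ?G4 = "G (range (Pair Red)) \<mu>R \<mu>R"
    have G1: "prob ?G1 \<le> \<epsilon> / 4"
      by (rule G) (use LB toss in \<open>simp_all add: measure_pmf_single\<close>)
    have G2: "prob ?G2 \<le> \<epsilon> / 4"
      by (rule G) (use LR toss assms(3,4) \<open>q $ kbar \<le> ?x\<close> in \<open>auto simp: measure_pmf_single\<close>)
    have G3: "prob ?G3 \<le> \<epsilon> / 4"
      by (rule G) (use nB color in auto)
    have G4: "prob ?G4 \<le> \<epsilon> / 4"
      by (rule G) (use nR color assms(4) in auto)
    let ?T = "{\<omega>. (1 - \<epsilon>) * (\<mu>B / \<mu>R) < posterior_odds \<mu>B \<mu>R \<pi> \<rho> kbar (observations n \<omega>)}"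
    \<comment> \<open>From here the argument is deterministic: outside the four events the counts
      satisfy the hypotheses of \<open>odds_margin\<close>.\<close>
    have good: "\<omega> \<in> ?T" if "\<omega> \<notin> ?G1 \<union> ?G2 \<union> ?G3 \<union> ?G4" for \<omega>
    proof -
      let ?xs = "observations n \<omega>"
      let ?y = "real (count_list ?xs (Blue, kbar))" and ?z = "real (count_list ?xs (Red, kbar))"
      let ?cB = "\<Sum>i\<in>UNIV. real (count_list ?xs (Blue, i))" and ?cR = "\<Sum>i\<in>UNIV. real (count_list ?xs (Red, i))"
      define EB where "EB = (\<integral>p. p $ kbar * posterior_density Blue \<pi> ?xs p \<partial>simplex_lebesgue)"
      define ER where "ER = (\<integral>q. q $ kbar * posterior_density Red \<rho> ?xs q \<partial>simplex_lebesgue)"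
      have dev: "\<bar>?y - n * (\<mu>B * ?x)\<bar> < \<delta> * (n * (\<mu>B * ?x))" "\<bar>?z - n * (\<mu>R * q $ kbar)\<bar> < \<delta> * (n * (\<mu>R * ?x))"
        "\<bar>?cB - n * \<mu>B\<bar> < \<delta> * (n * \<mu>B)" "\<bar>?cR - n * \<mu>R\<bar> < \<delta> * (n * \<mu>R)"
        using that unfolding G_def length_filter_color length_filter_singleton by (auto simp: not_le)
      have "SB \<le> ?cB"
      proof -
        have "SB \<le> (1 - \<delta>) * (n * \<mu>B)"
          using N(4) mult_left_mono[OF nB, of "1 - \<delta>"] \<delta> by linarith
        also have "\<dots> \<le> ?cB" using dev(3) by (simp add: left_diff_distrib)
        finally show ?thesis .
      qed
      then have EB: "\<bar>EB - (\<alpha> $ kbar + ?y) / (?A + ?cB)\<bar> \<le> \<delta> * ((\<alpha> $ kbar + ?y) / (?A + ?cB))"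
        using SB[of ?xs Blue kbar] by (simp add: Let_def EB_def)
      have "SR \<le> ?cR"
      proof -
        have "SR \<le> (1 - \<delta>) * (n * \<mu>R)"
          using N(5) mult_left_mono[OF nR, of "1 - \<delta>"] \<delta> by linarith
        also have "\<dots> \<le> ?cR" using dev(4) by (simp add: left_diff_distrib)
        finally show ?thesis .
      qed
      then have ER: "\<bar>ER - (\<alpha>' $ kbar + ?z) / (?A' + ?cR)\<bar> \<le> \<delta> * ((\<alpha>' $ kbar + ?z) / (?A' + ?cR))"
        using SR[of ?xs Red kbar] by (simp add: Let_def ER_def)
      have "n * (\<mu>R * q $ kbar) \<le> n * (\<mu>R * ?x)"
        using \<open>q $ kbar \<le> ?x\<close> assms(3,4) by (intro mult_left_mono) auto
      \<comment> \<open>The assumption \<open>q $ kbar \<le> p $ kbar\<close> turns the two-sided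
        deviation into an upper bound in terms of the blue probability.\<close>
      then have z: "?z < (1 + \<delta>) * (n * \<mu>R * ?x)"
        using dev(2) by (simp add: distrib_right mult.assoc)
      have A: "?A \<le> \<delta> * (n * \<mu>B)"
        using N(2) mult_left_mono[OF nB, of \<delta>] \<delta> by linarith
      have a': "\<alpha>' $ kbar \<le> \<delta> * (n * \<mu>R * ?x)"
        using \<alpha>'_le N(3) mult_left_mono[OF LR, of \<delta>] \<delta> unfolding mult.assoc by linarith
      have margin: "0 < ER" "(1 - 10 * \<delta>) * ER < EB"
        using odds_margin[OF \<delta> _ _ \<open>0 < ?x\<close> less_imp_le[OF \<alpha>(1)] \<alpha>_le A \<alpha>'(1) \<alpha>'_le a' _ dev(3) z _ dev(4) EB ER]
          dev(1) \<open>0 < n\<close> assms(2-4) by (auto simp: mult.assoc)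
      \<comment> \<open>Positivity of \<open>ER\<close> matters here: without it the quotient could
        be the default value of division by 0.\<close>
      have "(1 - \<epsilon>) * (\<mu>B / \<mu>R) = (\<mu>B / \<mu>R) * (((1 - 10 * \<delta>) * ER) / ER)"
        using margin(1) by (simp add: \<delta>_def)
      also have "\<dots> < (\<mu>B / \<mu>R) * (EB / ER)"
        using margin assms(2-4) by (intro mult_strict_left_mono divide_strict_right_mono) auto
      also have "\<dots> = posterior_odds \<mu>B \<mu>R \<pi> \<rho> kbar ?xs"
        by (simp add: posterior_odds_def EB_def ER_def)
      finally show ?thesis by simp
    qed
    have "prob (?G1 \<union> ?G2 \<union> ?G3 \<union> ?G4) \<le> prob ?G1 + prob ?G2 + prob ?G3 + prob ?G4"
      using measure_Un_le[OF G_sets G_sets, of "{(Blue, kbar)}" "\<mu>B * ?x" "\<mu>B * ?x" "{(Red, kbar)}" "\<mu>R * q $ kbar" "\<mu>R * ?x"]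
        measure_Un_le[of "?G1 \<union> ?G2" ?D ?G3] measure_Un_le[of "?G1 \<union> ?G2 \<union> ?G3" ?D ?G4] by auto
    also have "\<dots> \<le> \<epsilon>" using G1 G2 G3 G4 by linarith
    finally have "1 - \<epsilon> \<le> 1 - prob (?G1 \<union> ?G2 \<union> ?G3 \<union> ?G4)" by simp
    also have "\<dots> = prob (space ?D - (?G1 \<union> ?G2 \<union> ?G3 \<union> ?G4))"
      by (rule prob_compl[symmetric]) simp
    also have "\<dots> \<le> prob ?T"
      using good by (intro finite_measure_mono observations_pred_sets) blast
    finally show "1 - \<epsilon> \<le> prob {\<omega> \<in> space ?D.
        (1 - \<epsilon>) * (\<mu>B / \<mu>R) < posterior_odds \<mu>B \<mu>R \<pi> \<rho> kbar (observations n \<omega>)}"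
      by simp
  qed
qed

end
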